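(* Let $t\ge 1$ be a fixed odd integer. In the insertion-only streaming model, any (randomized, single-pass) algorithm that can distinguish whether a planar graph on $4n+2$ vertices is bipartite or is $\frac{1}{4t+2}$-far from being bipartite must use $\Omega(n^{1-1/t})$ bits of space.
   Context: In the insertion-only streaming model the input graph is given as a stream of edge insertions and no deletions. The algorithm is randomized and required to succeed with constant probability. A graph with $m$ edges is $\delta$-far from being bipartite if one has to delete at least $\delta m$ edges to obtain a bipartite graph. *)

theory Defs
  imports "HOL-Probability.Probability"
begin

definition simple_graph :: "'a set \<Rightarrow> 'a set set \<Rightarrow> bool" where
  "simple_graph V E \<longleftrightarrow> finite V \<and> (\<forall>e\<in>E. e \<subseteq> V \<and> card e = 2)"

text \<open>
  Existence of a drawing without crossings: distinct points for the vertices, and for every edge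
  a simple arc joining its end points that avoids all other vertices and meets the arcs of the
  other edges only in common end points.
\<close>

definition planar :: "'a set \<Rightarrow> 'a set set \<Rightarrow> bool" where
  "planar V E \<longleftrightarrow>
     (\<exists>(pos :: 'a \<Rightarrow> real ^ 2) (\<gamma> :: 'a set \<Rightarrow> real \<Rightarrow> real ^ 2).
        inj_on pos V \<and>
        (\<forall>e\<in>E. arc (\<gamma> e) \<and> {pathstart (\<gamma> e), pathfinish (\<gamma> e)} = pos ` e \<and>
               path_image (\<gamma> e) \<inter> pos ` V = pos ` e) \<and>
        (\<forall>e\<in>E. \<forall>f\<in>E. e \<noteq> f \<longrightarrow> path_image (\<gamma> e) \<inter> path_image (\<gamma> f) = pos ` (e \<inter> f)))"

definition bipartite :: "'a set \<Rightarrow> 'a set set \<Rightarrow> bool" where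
  "bipartite V E \<longleftrightarrow>
     (\<exists>X Y. X \<union> Y = V \<and> X \<inter> Y = {} \<and> (\<forall>e\<in>E. \<exists>x\<in>X. \<exists>y\<in>Y. e = {x, y}))"

definition far_from_bipartite :: "real \<Rightarrow> 'a set \<Rightarrow> 'a set set \<Rightarrow> bool" where
  "far_from_bipartite \<delta> V E \<longleftrightarrow>
     (\<forall>F\<subseteq>E. bipartite V (E - F) \<longrightarrow> \<delta> * real (card E) \<le> real (card F))"

text \<open>
  The memory content is a bit string. Every step may use fresh random bits, which are free unless
  they are kept in memory. There is no restriction on computability or running time.
\<close>

record stream_alg =
  init :: "bool list pmf"
  update :: "bool list \<Rightarrow> nat set \<Rightarrow> bool list pmf"
  answer :: "bool list \<Rightarrow> bool pmf"

definition run :: "stream_alg \<Rightarrow> nat set list \<Rightarrow> bool list pmf" where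
  "run A \<sigma> = foldl (\<lambda>D e. bind_pmf D (\<lambda>m. update A m e)) (init A) \<sigma>"

definition outcome :: "stream_alg \<Rightarrow> nat set list \<Rightarrow> bool pmf" where
  "outcome A \<sigma> = bind_pmf (run A \<sigma>) (answer A)"

text \<open>Worst case over the inputs, the coin tosses and the moments between two insertions.\<close>

definition uses_space :: "stream_alg \<Rightarrow> nat set list set \<Rightarrow> nat \<Rightarrow> bool" where
  "uses_space A I s \<longleftrightarrow>
     (\<forall>\<sigma>\<in>I. \<forall>k\<le>length \<sigma>. \<forall>m\<in>set_pmf (run A (take k \<sigma>)). length m \<le> s)"

definition planar_streams :: "nat \<Rightarrow> nat set list set" where
  "planar_streams N =
     {\<sigma>. distinct \<sigma> \<and> simple_graph {..<N} (set \<sigma>) \<and> planar {..<N} (set \<sigma>)}"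

text \<open>
  The graph without edges is bipartite and also, formally, \<open>\<delta>\<close>-far from being bipartite. It is
  counted as bipartite only: otherwise no algorithm could meet the specification below. For graphs
  with an edge and \<open>\<delta> > 0\<close>, being \<open>\<delta>\<close>-far already excludes being bipartite.
\<close>

definition yes_streams :: "nat \<Rightarrow> nat set list set" where
  "yes_streams N = {\<sigma> \<in> planar_streams N. bipartite {..<N} (set \<sigma>)}"

definition no_streams :: "real \<Rightarrow> nat \<Rightarrow> nat set list set" where
  "no_streams \<delta> N =
     {\<sigma> \<in> planar_streams N. far_from_bipartite \<delta> {..<N} (set \<sigma>) \<and> \<not> bipartite {..<N} (set \<sigma>)}"

definition distinguishes :: "real \<Rightarrow> stream_alg \<Rightarrow> real \<Rightarrow> nat \<Rightarrow> bool" where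
  "distinguishes p A \<delta> N \<longleftrightarrow>
     (\<forall>\<sigma>\<in>yes_streams N. pmf (outcome A \<sigma>) True \<ge> p) \<and>
     (\<forall>\<sigma>\<in>no_streams \<delta> N. pmf (outcome A \<sigma>) False \<ge> p)"

end

theory Submission
  imports Defs
begin

text \<open>
  Let \<open>k = 2t\<close>, let \<open>g\<close> be even and \<open>N = kg\<close>. A stream starts with gadgets that encode \<open>N\<close> hidden
  bits \<open>X\<close>: bit \<open>i\<close> decides whether two parallel edges between \<open>upper i\<close> and \<open>lower i\<close> are crossed.
  It continues with edges that thread the gadgets, in blocks of \<open>k\<close> given by a permutation \<open>p\<close>, into
  double strands; block \<open>j\<close> is closed up with a twist if \<open>j \<in> W\<close>. If \<open>W\<close> is the set of blocks of odd
  parity, then every block consists of two odd cycles of length \<open>2k + 1\<close>; if it is the complement,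
  then every block is a single cycle of length \<open>4k + 2\<close>. So the memory after the first part is a
  one-way message from which the two values of \<open>W\<close> must be told apart.

  For a message with weight function \<open>f\<close> on the inputs \<open>X\<close>, Parseval bounds the square of its
  advantage by the Fourier weight of \<open>f\<close> on the sets \<open>p ` blocks k V\<close> with \<open>|V|\<close> odd, on average
  over \<open>p\<close>. For \<open>V\<close> of medium size Parseval and a binomial estimate suffice. For small \<open>V\<close>, the
  average over \<open>p\<close> is dominated by the sum over all tuples of indices, which equals a moment of the
  correlation of two inputs drawn from \<open>f\<close>; as \<open>f\<close> has density at least \<open>2^{-s}\<close> this is
  controlled by Khintchine's inequality. This loses a square against hypercontractivity, which the
  choice \<open>k = 2t\<close> instead of \<open>k = t\<close> pays for. Large \<open>V\<close> reduce to small ones by complementation.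
\<close>

section \<open>Disjoint unions of cycles\<close>

definition parabola :: "real \<Rightarrow> real^2" where
  "parabola x = vector [x, x\<^sup>2]"

lemma parabola_nth [simp]: "parabola x $ 1 = x" "parabola x $ 2 = x\<^sup>2"
  by (simp_all add: parabola_def)

lemma parabola_eq_iff [simp]: "parabola x = parabola y \<longleftrightarrow> x = y"
  by (metis parabola_nth(1))

lemma parabola_eqI: "z $ 2 = (z $ 1)\<^sup>2 \<Longrightarrow> z = parabola (z $ 1)"
  by (simp add: vec_eq_iff forall_2)

lemma parabola_chord:
  assumes "z \<in> closed_segment (parabola a) (parabola b)" and "a \<le> b"
  shows "a \<le> z $ 1" and "z $ 1 \<le> b" and "z $ 2 - (z $ 1)\<^sup>2 = (z $ 1 - a) * (b - z $ 1)"
proof -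
  obtain u where u: "0 \<le> u" "u \<le> 1" and z: "z = (1 - u) *\<^sub>R parabola a + u *\<^sub>R parabola b"
    using assms(1) unfolding closed_segment_def by blast
  have z_1: "z $ 1 = a + u * (b - a)" and z_2: "z $ 2 = (1 - u) * a\<^sup>2 + u * b\<^sup>2"
    unfolding z by (simp_all add: algebra_simps)
  show "a \<le> z $ 1"
    using u assms(2) z_1 by simp
  have "u * (b - a) \<le> 1 * (b - a)"
    using u assms(2) by (intro mult_right_mono) auto
  then show "z $ 1 \<le> b"
    using z_1 by simp
  show "z $ 2 - (z $ 1)\<^sup>2 = (z $ 1 - a) * (b - z $ 1)"
    unfolding z_1 z_2 by (simp add: algebra_simps power2_eq_square)
qed

lemma parabola_mem_chord_iff:
  assumes "a \<le> b"
  shows "parabola x \<in> closed_segment (parabola a) (parabola b) \<longleftrightarrow> x = a \<or> x = b"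
  using parabola_chord(3)[OF _ assms, of "parabola x"] by auto

lemma nested_interval_products_eqD:
  fixes a b c d x :: real
  assumes "a \<le> c" "c \<le> x" "x \<le> d" "d \<le> b" and "(a, b) \<noteq> (c, d)"
    and products_eq: "(x - a) * (b - x) = (x - c) * (d - x)"
  shows "(x = a \<or> x = b) \<and> (x = c \<or> x = d)"
proof -
  have "(x - a) * (b - x) = (x - c) * (d - x) + (x - c) * (b - d) + (c - a) * (b - x)"
    by (simp add: algebra_simps)
  then have "(x - c) * (b - d) + (c - a) * (b - x) = 0"
    using products_eq by simp
  moreover have "(x - c) * (b - d) \<ge> 0" "(c - a) * (b - x) \<ge> 0"
    using assms(1-4) by auto
  ultimately have "(x - c) * (b - d) = 0" "(c - a) * (b - x) = 0"
    by linarith+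
  then show ?thesis
    using assms(1-5) by auto
qed

lemma parabola_chords_Int:
  assumes "a < b" "c < d" "(a, b) \<noteq> (c, d)"
    and noncrossing: "\<not> (a < c \<and> c < b \<and> b < d)" "\<not> (c < a \<and> a < d \<and> d < b)"
  shows "closed_segment (parabola a) (parabola b) \<inter> closed_segment (parabola c) (parabola d) =
    parabola ` ({a, b} \<inter> {c, d})"
proof (intro subset_antisym subsetI)
  fix z
  assume z: "z \<in> closed_segment (parabola a) (parabola b) \<inter> closed_segment (parabola c) (parabola d)"
  define x where "x = z $ 1"
  note ab = parabola_chord[of z a b, folded x_def] and cd = parabola_chord[of z c d, folded x_def]
  have products_eq: "(x - a) * (b - x) = (x - c) * (d - x)"
    using z ab(3) cd(3) assms by simp
  consider (before) "b \<le> c" | (after) "d \<le> a" | (around) "a \<le> c" "d \<le> b" | (inside) "c \<le> a" "b \<le> d"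
    using noncrossing by linarith
  then have x: "(x = a \<or> x = b) \<and> (x = c \<or> x = d)"
  proof cases
    case around
    then show ?thesis
      using nested_interval_products_eqD[OF _ _ _ _ assms(3) products_eq] z cd assms by simp
  next
    case inside
    then show ?thesis
      using nested_interval_products_eqD[OF _ _ _ _ assms(3)[symmetric] products_eq[symmetric]]
        z ab assms by simp
  qed (use z ab cd assms in auto)
  then have "z = parabola x"
    unfolding x_def using ab(3) z assms by (intro parabola_eqI) (auto simp: x_def)
  with x show "z \<in> parabola ` ({a, b} \<inter> {c, d})"
    by blast
qed auto

definition noncrossing :: "('a \<Rightarrow> 'b::linorder) \<Rightarrow> 'a set set \<Rightarrow> bool" where
  "noncrossing r E \<longleftrightarrow>
     (\<forall>a b c d. {a, b} \<in> E \<and> {c, d} \<in> E \<longrightarrow> \<not> (r a < r c \<and> r c < r b \<and> r b < r d))"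

lemma simple_graph_edgeE:
  assumes "simple_graph V E" "e \<in> E"
  obtains u v where "e = {u, v}" "u \<noteq> v" "u \<in> V" "v \<in> V"
proof -
  have "card e = 2" "e \<subseteq> V"
    using assms by (auto simp: simple_graph_def)
  then show ?thesis
    using that by (auto simp: card_2_iff)
qed

lemma planar_straight_lineI:
  fixes pos :: "'a \<Rightarrow> real^2"
  assumes graph: "simple_graph V E" and inj: "inj_on pos V"
    and vertices: "\<And>e. e \<in> E \<Longrightarrow> convex hull (pos ` e) \<inter> pos ` V = pos ` e"
    and edges: "\<And>e f. e \<in> E \<Longrightarrow> f \<in> E \<Longrightarrow> e \<noteq> f \<Longrightarrow>
      convex hull (pos ` e) \<inter> convex hull (pos ` f) = pos ` (e \<inter> f)"
  shows "planar V E"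
proof -
  have "\<exists>c. arc c \<and> {pathstart c, pathfinish c} = pos ` e \<and> path_image c = convex hull (pos ` e)"
    if "e \<in> E" for e
  proof -
    obtain u v where uv: "e = {u, v}" "u \<noteq> v" "u \<in> V" "v \<in> V"
      using simple_graph_edgeE[OF graph \<open>e \<in> E\<close>] .
    then have "pos u \<noteq> pos v"
      using inj by (auto dest: inj_onD)
    then show ?thesis
      by (intro exI[of _ "linepath (pos u) (pos v)"]) (simp add: uv(1) segment_convex_hull)
  qed
  then obtain \<gamma> where \<gamma>: "\<And>e. e \<in> E \<Longrightarrow>
      arc (\<gamma> e) \<and> {pathstart (\<gamma> e), pathfinish (\<gamma> e)} = pos ` e \<and>
      path_image (\<gamma> e) = convex hull (pos ` e)"
    by metis
  show ?thesis
    unfolding planar_def using inj \<gamma> vertices edges by (intro exI[of _ pos] exI[of _ \<gamma>]) simp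
qed

lemma simple_graph_ordered_edgeE:
  fixes r :: "'a \<Rightarrow> 'b::linorder"
  assumes "simple_graph V E" "inj_on r V" "e \<in> E"
  obtains a b where "e = {a, b}" "a \<in> V" "b \<in> V" "r a < r b"
proof -
  obtain u v where uv: "e = {u, v}" "u \<noteq> v" "u \<in> V" "v \<in> V"
    using simple_graph_edgeE[OF assms(1,3)] .
  then have "r u \<noteq> r v"
    using assms(2) by (auto dest: inj_onD)
  then consider (less) "r u < r v" | (greater) "r v < r u"
    by (rule linorder_neqE)
  then show ?thesis
  proof cases
    case less
    show ?thesis
      using uv(1,3,4) less by (rule that)
  next
    case greater
    have "e = {v, u}"
      using uv(1) by (simp only: insert_commute)
    then show ?thesis
      using uv(4,3) greater by (rule that)
  qed
qed

text \<open>Points on a parabola are in convex position, so the chords of noncrossing edges do not cross.\<close>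

lemma planar_if_noncrossing:
  fixes r :: "'a \<Rightarrow> real"
  assumes graph: "simple_graph V E" and inj: "inj_on r V" and nc: "noncrossing r E"
  shows "planar V E"
proof (rule planar_straight_lineI[OF graph])
  let ?pos = "\<lambda>v. parabola (r v)"
  show "inj_on ?pos V"
    using inj by (simp add: inj_on_def)
  show "convex hull (?pos ` e) \<inter> ?pos ` V = ?pos ` e" if e: "e \<in> E" for e
  proof -
    obtain a b where "e = {a, b}" "a \<in> V" "b \<in> V" "r a < r b"
      using simple_graph_ordered_edgeE[OF graph inj e] .
    then show ?thesis
      by (auto simp: parabola_mem_chord_iff less_imp_le simp flip: segment_convex_hull)
  qed
  show "convex hull (?pos ` e) \<inter> convex hull (?pos ` f) = ?pos ` (e \<inter> f)"
    if e: "e \<in> E" and f: "f \<in> E" and "e \<noteq> f" for e f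
  proof -
    obtain a b where ab: "e = {a, b}" "a \<in> V" "b \<in> V" "r a < r b"
      using simple_graph_ordered_edgeE[OF graph inj e] .
    obtain c d where cd: "f = {c, d}" "c \<in> V" "d \<in> V" "r c < r d"
      using simple_graph_ordered_edgeE[OF graph inj f] .
    have "(r a, r b) \<noteq> (r c, r d)"
      using \<open>e \<noteq> f\<close> ab cd inj by (auto dest: inj_onD)
    moreover have "\<not> (r a < r c \<and> r c < r b \<and> r b < r d)" "\<not> (r c < r a \<and> r a < r d \<and> r d < r b)"
      using nc e f unfolding ab(1) cd(1) noncrossing_def by blast+
    ultimately have "closed_segment (?pos a) (?pos b) \<inter> closed_segment (?pos c) (?pos d) =
        parabola ` ({r a, r b} \<inter> {r c, r d})"
      using ab(4) cd(4) by (intro parabola_chords_Int)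
    also have "{r a, r b} \<inter> {r c, r d} = r ` (e \<inter> f)"
      using inj_on_image_Int[OF inj, of e f] ab(1-3) cd(1-3) by simp
    finally show ?thesis
      by (simp add: ab(1) cd(1) segment_convex_hull image_image)
  qed
qed

lemma noncrossing_image:
  assumes inj: "inj_on \<phi> V" and sub: "\<And>e. e \<in> E \<Longrightarrow> e \<subseteq> V"
    and r: "\<And>v. v \<in> V \<Longrightarrow> r (\<phi> v) = s v" and nc: "noncrossing s E"
  shows "noncrossing r ((`) \<phi> ` E)"
proof -
  have preimage: "\<exists>a' b'. {a', b'} \<in> E \<and> r a = s a' \<and> r b = s b'"
    if edge: "{a, b} \<in> (`) \<phi> ` E" for a b
  proof -
    obtain e where e: "e \<in> E" "{a, b} = \<phi> ` e"
      using edge by (elim imageE) simp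
    then have "a \<in> \<phi> ` e" "b \<in> \<phi> ` e"
      by blast+
    then obtain a' b' where ab: "a' \<in> e" "b' \<in> e" "a = \<phi> a'" "b = \<phi> b'"
      by (elim imageE) simp
    have "\<phi> ` {a', b'} = \<phi> ` e"
      using e(2) ab by simp
    then have "{a', b'} = e"
      using inj sub[OF e(1)] ab by (subst (asm) inj_on_image_eq_iff[of \<phi> V]) auto
    then have "{a', b'} \<in> E"
      using e(1) by simp
    moreover have "r a = s a'" "r b = s b'"
      using ab r sub[OF e(1)] by auto
    ultimately show ?thesis
      by (intro exI conjI)
  qed
  show ?thesis
    unfolding noncrossing_def
  proof (intro allI impI, elim conjE)
    fix a b c d assume ab: "{a, b} \<in> (`) \<phi> ` E" and cd: "{c, d} \<in> (`) \<phi> ` E"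
    obtain a' b' where "{a', b'} \<in> E" and r_ab: "r a = s a'" "r b = s b'"
      using preimage[OF ab] by blast
    moreover obtain c' d' where "{c', d'} \<in> E" and r_cd: "r c = s c'" "r d = s d'"
      using preimage[OF cd] by blast
    ultimately show "\<not> (r a < r c \<and> r c < r b \<and> r b < r d)"
      using nc unfolding r_ab r_cd noncrossing_def by blast
  qed
qed

lemma bipartite_closed_walk_even:
  assumes "bipartite V E" and walk: "\<And>i. i < n \<Longrightarrow> {v i, v (Suc i)} \<in> E" and closed: "v n = v 0"
  shows "even n"
proof -
  obtain X Y where XY: "X \<inter> Y = {}" "\<And>e. e \<in> E \<Longrightarrow> \<exists>x\<in>X. \<exists>y\<in>Y. e = {x, y}"
    using assms(1) unfolding bipartite_def by metis
  have "i \<le> n \<Longrightarrow> v i \<in> X \<longleftrightarrow> (v 0 \<in> X \<longleftrightarrow> even i)" for i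
  proof (induction i)
    case (Suc i)
    have "v (Suc i) \<in> X \<longleftrightarrow> v i \<notin> X"
      using XY(1) XY(2)[OF walk[of i]] Suc.prems by (auto simp: doubleton_eq_iff)
    then show ?case
      using Suc by auto
  qed simp
  from this[of n] show ?thesis
    unfolding closed by auto
qed

lemma far_from_bipartite_antimono:
  assumes "far_from_bipartite \<delta> V E" and "\<epsilon> \<le> \<delta>"
  shows "far_from_bipartite \<epsilon> V E"
  unfolding far_from_bipartite_def
proof (intro allI impI)
  fix F assume "F \<subseteq> E" "bipartite V (E - F)"
  then have "\<delta> * real (card E) \<le> real (card F)"
    using assms(1) unfolding far_from_bipartite_def by blast
  moreover have "\<epsilon> * real (card E) \<le> \<delta> * real (card E)"
    using assms(2) by (rule mult_right_mono) simp
  ultimately show "\<epsilon> * real (card E) \<le> real (card F)"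
    by linarith
qed

definition cyc_succ :: "nat \<Rightarrow> nat \<Rightarrow> nat" where
  "cyc_succ L i = L * (i div L) + Suc i mod L"

definition disjoint_cycles :: "nat \<Rightarrow> nat \<Rightarrow> nat set set" where
  "disjoint_cycles L h = (\<lambda>i. {i, cyc_succ L i}) ` {..<L * h}"

lemma cyc_succ_mult_add:
  assumes "r < L"
  shows "cyc_succ L (L * q + r) = L * q + Suc r mod L"
proof -
  have "Suc (L * q + r) mod L = Suc r mod L"
    by (metis add_Suc_right mod_mult_self4 mult.commute)
  then show ?thesis
    using assms by (simp add: cyc_succ_def)
qed

lemma cyc_succ_mod: "cyc_succ L i mod L = Suc i mod L"
  by (simp add: cyc_succ_def)

lemma cyc_succ_div: "L > 0 \<Longrightarrow> cyc_succ L i div L = i div L"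
  by (simp add: cyc_succ_def)

lemma cyc_succ_less:
  assumes "i < L * h"
  shows "cyc_succ L i < L * h"
proof -
  have "L > 0"
    using assms by (cases L) auto
  then show ?thesis
    using assms cyc_succ_div[of L i] by (metis div_less_iff_less_mult mult.commute)
qed

lemma cyc_succ_neq:
  assumes "L \<ge> 2"
  shows "cyc_succ L i \<noteq> i"
proof
  assume "cyc_succ L i = i"
  then have "Suc i mod L = i mod L"
    using cyc_succ_mod[of L i] by simp
  then show False
    using assms by (auto simp: mod_Suc split: if_splits)
qed

lemma cyc_succ_twice_neq:
  assumes "L \<ge> 3"
  shows "cyc_succ L (cyc_succ L i) \<noteq> i"
proof
  assume "cyc_succ L (cyc_succ L i) = i"
  then have "Suc (Suc i) mod L = i mod L"
    using cyc_succ_mod by (metis mod_Suc_eq)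
  then show False
    using assms by (auto simp: mod_Suc split: if_splits)
qed

lemma inj_cycle_edge: "L \<ge> 3 \<Longrightarrow> inj (\<lambda>i. {i, cyc_succ L i})"
  by (rule injI) (metis cyc_succ_twice_neq doubleton_eq_iff)

lemma disjoint_cycles_long_edge:
  assumes "{a, b} \<in> disjoint_cycles L h" and "Suc a < b"
  shows "L dvd a" and "b div L = a div L"
proof -
  obtain i where i: "{a, b} = {i, cyc_succ L i}" and "L > 0"
    using assms(1) by (cases L) (auto simp: disjoint_cycles_def)
  have succ_i: "cyc_succ L i = (if Suc (i mod L) = L then L * (i div L) else Suc i)"
    by (simp add: cyc_succ_def mod_Suc)
  have "cyc_succ L i \<le> Suc i"
    unfolding succ_i by (simp add: le_SucI)
  then have ends: "b = i" "a = cyc_succ L i"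
    using i assms(2) by (auto simp: doubleton_eq_iff)
  moreover have "Suc (i mod L) = L"
    using ends assms(2) succ_i by (metis Suc_lessD Suc_n_not_le_n less_imp_le)
  ultimately show "L dvd a" "b div L = a div L"
    using succ_i cyc_succ_div[OF \<open>L > 0\<close>] by simp_all
qed

lemma noncrossing_disjoint_cycles: "noncrossing (\<lambda>i. i) (disjoint_cycles L h)"
  unfolding noncrossing_def
proof (intro allI impI notI, elim conjE)
  fix a b c d assume edges: "{a, b} \<in> disjoint_cycles L h" "{c, d} \<in> disjoint_cycles L h"
    and less: "a < c" "c < b" "b < d"
  have "L dvd a" "b div L = a div L" "L dvd c"
    using disjoint_cycles_long_edge edges less by auto
  moreover have "a div L \<le> c div L" "c div L \<le> b div L"
    using less by (auto intro: div_le_mono)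
  ultimately show False
    using less by (metis div_mult_mod_eq dvd_div_mult_self le_add1 le_antisym not_less)
qed

locale cycle_embedding =
  fixes L h :: nat and \<phi> :: "nat \<Rightarrow> 'a" and V :: "'a set"
  assumes L_ge: "L \<ge> 3" and inj: "inj_on \<phi> {..<L * h}"
    and image_subset: "\<phi> ` {..<L * h} \<subseteq> V" and finite_V: "finite V"
begin

abbreviation edges :: "'a set set" where
  "edges \<equiv> (`) \<phi> ` disjoint_cycles L h"

lemma disjoint_cycles_edge_subset: "e \<in> disjoint_cycles L h \<Longrightarrow> e \<subseteq> {..<L * h}"
  by (auto simp: disjoint_cycles_def cyc_succ_less)

lemma L_pos: "L > 0"
  using L_ge by simp

lemma cycle_edge_mem: "i < L * h \<Longrightarrow> \<phi> ` {i, cyc_succ L i} \<in> edges"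
  unfolding disjoint_cycles_def by (intro imageI) simp

lemma simple_graph: "simple_graph V edges"
proof -
  have "\<phi> ` e \<subseteq> V \<and> card (\<phi> ` e) = 2" if e: "e \<in> disjoint_cycles L h" for e
  proof -
    have "inj_on \<phi> e"
      using inj disjoint_cycles_edge_subset[OF e] by (rule inj_on_subset)
    moreover have "card e = 2"
      using e cyc_succ_neq[of L] L_ge by (auto simp: disjoint_cycles_def card_2_iff)
    ultimately show ?thesis
      using disjoint_cycles_edge_subset[OF e] image_subset by (auto simp: card_image)
  qed
  then show ?thesis
    using finite_V by (auto simp: simple_graph_def)
qed

lemma card_edges: "card edges = L * h"
proof -
  have "inj_on ((`) \<phi>) (disjoint_cycles L h)"
    using inj disjoint_cycles_edge_subset by (intro inj_on_subset[OF inj_on_image_Pow]) auto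
  moreover have "card (disjoint_cycles L h) = L * h"
    unfolding disjoint_cycles_def using inj_on_subset[OF inj_cycle_edge[OF L_ge]]
    by (simp add: card_image)
  ultimately show ?thesis
    by (simp add: card_image)
qed

lemma planar: "planar V edges"
proof -
  let ?A = "{..<L * h}"
  obtain f :: "'a \<Rightarrow> nat" where f: "inj_on f V"
    using finite_imp_inj_to_nat_seg[OF finite_V] by blast
  define r where "r v = (if v \<in> \<phi> ` ?A then the_inv_into ?A \<phi> v else L * h + f v)" for v
  have r_image: "r (\<phi> i) = i" if "i \<in> ?A" for i
    using that inj by (auto simp: r_def the_inv_into_f_f)
  have r_outside: "r v = L * h + f v" if "v \<notin> \<phi> ` ?A" for v
    using that by (simp add: r_def)
  have "inj_on r V"
  proof (rule inj_onI)
    fix v w assume vw: "v \<in> V" "w \<in> V" "r v = r w"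
    show "v = w"
    proof (cases "v \<in> \<phi> ` ?A")
      case True
      then show ?thesis
        using vw(3) r_image r_outside[of w] by fastforce
    next
      case False
      then show ?thesis
        using vw f r_image r_outside by (cases "w \<in> \<phi> ` ?A") (auto dest: inj_onD)
    qed
  qed
  moreover have "noncrossing r edges"
    using inj disjoint_cycles_edge_subset r_image noncrossing_disjoint_cycles
    by (rule noncrossing_image)
  then have "noncrossing (\<lambda>v. real (r v)) edges"
    by (simp add: noncrossing_def)
  ultimately show ?thesis
    by (intro planar_if_noncrossing[OF simple_graph, of "\<lambda>v. real (r v)"]) (auto simp: inj_on_def)
qed

lemma bipartite_if_even:
  assumes "even L"
  shows "bipartite V edges"
proof -
  define X where "X = \<phi> ` {i. i < L * h \<and> even i}"
  have mem_X_iff: "\<phi> i \<in> X \<longleftrightarrow> even i" if "i < L * h" for i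
    using that inj unfolding X_def inj_on_def by auto
  have "\<exists>x\<in>X. \<exists>y\<in>V - X. \<phi> ` {i, cyc_succ L i} = {x, y}" if i: "i < L * h" for i
  proof -
    let ?j = "cyc_succ L i"
    have j: "?j < L * h"
      by (rule cyc_succ_less[OF i])
    have "even ?j \<longleftrightarrow> odd i"
      using assms by (simp add: cyc_succ_def dvd_mod_iff)
    then have "\<phi> i \<in> X \<and> \<phi> ?j \<in> V - X \<or> \<phi> ?j \<in> X \<and> \<phi> i \<in> V - X"
      using mem_X_iff[OF i] mem_X_iff[OF j] image_subset i j by auto
    then show ?thesis
      by (auto simp: insert_commute)
  qed
  moreover have "X \<subseteq> V"
    using image_subset by (auto simp: X_def)
  ultimately show ?thesis
    unfolding bipartite_def disjoint_cycles_def by (intro exI[of _ X] exI[of _ "V - X"]) auto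
qed

lemma bipartite_deletion_meets_odd_cycle:
  assumes "odd L" and bip: "bipartite V (edges - F)" and "q < h"
  shows "\<exists>i<L * h. i div L = q \<and> \<phi> ` {i, cyc_succ L i} \<in> F"
proof (rule ccontr)
  assume "\<not> ?thesis"
  then have avoid: "\<phi> ` {i, cyc_succ L i} \<notin> F" if "i < L * h" "i div L = q" for i
    using that by blast
  define v where "v r = \<phi> (L * q + r mod L)" for r
  have "{v r, v (Suc r)} \<in> edges - F" if "r < L" for r
  proof -
    let ?i = "L * q + r"
    have i_div: "?i div L = q"
      using that by simp
    moreover have i_less: "?i < L * h"
      using i_div \<open>q < h\<close> that by (metis L_pos div_less_iff_less_mult mult.commute)
    moreover have "{v r, v (Suc r)} = \<phi> ` {?i, cyc_succ L ?i}"
      using that by (simp add: v_def cyc_succ_mult_add)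
    ultimately show ?thesis
      using avoid[OF i_less i_div] cycle_edge_mem[OF i_less] by (metis DiffI)
  qed
  then have "even L"
    by (rule bipartite_closed_walk_even[OF bip, where v = v]) (simp_all add: v_def)
  then show False
    using \<open>odd L\<close> by simp
qed

lemma bipartite_deletion_card_ge:
  assumes "odd L" and F: "F \<subseteq> edges" and bip: "bipartite V (edges - F)"
  shows "h \<le> card F"
proof -
  define meets where "meets q i \<longleftrightarrow> i < L * h \<and> i div L = q \<and> \<phi> ` {i, cyc_succ L i} \<in> F" for q i
  have "\<forall>q\<in>{..<h}. \<exists>i. meets q i"
    unfolding meets_def using bipartite_deletion_meets_odd_cycle[OF assms(1) bip] by simp
  then obtain i where "\<forall>q\<in>{..<h}. meets q (i q)"
    by (rule bchoice[THEN exE])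
  then have i: "i q < L * h" "i q div L = q" "\<phi> ` {i q, cyc_succ L (i q)} \<in> F" if "q \<in> {..<h}" for q
    using that by (simp_all add: meets_def)
  have vertices: "{i q, cyc_succ L (i q)} \<subseteq> {..<L * h}" if "q \<in> {..<h}" for q
    using i(1)[OF that] cyc_succ_less by simp
  have "inj_on (\<lambda>q. \<phi> ` {i q, cyc_succ L (i q)}) {..<h}"
  proof (rule inj_onI)
    fix p q assume pq: "p \<in> {..<h}" "q \<in> {..<h}"
      and image_eq: "\<phi> ` {i p, cyc_succ L (i p)} = \<phi> ` {i q, cyc_succ L (i q)}"
    have "{i p, cyc_succ L (i p)} = {i q, cyc_succ L (i q)}"
      using inj_on_image_eq_iff[OF inj vertices[OF pq(1)] vertices[OF pq(2)]] image_eq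
      by (rule iffD1)
    then have "i p div L = i q div L"
      using injD[OF inj_cycle_edge[OF L_ge], of "i p" "i q"] by simp
    then show "p = q"
      unfolding i(2)[OF pq(1)] i(2)[OF pq(2)] .
  qed
  moreover have "(\<lambda>q. \<phi> ` {i q, cyc_succ L (i q)}) ` {..<h} \<subseteq> F"
    by (intro image_subsetI i(3))
  moreover have "finite F"
    using F by (rule finite_subset) (simp add: disjoint_cycles_def)
  ultimately have "card {..<h} \<le> card F"
    by (rule card_inj_on_le)
  then show ?thesis
    by simp
qed

lemma not_bipartite_if_odd: "odd L \<Longrightarrow> h > 0 \<Longrightarrow> \<not> bipartite V edges"
  using bipartite_deletion_card_ge[of "{}"] by auto

lemma far_from_bipartite_if_odd:
  assumes "odd L"
  shows "far_from_bipartite (1 / real L) V edges"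
  unfolding far_from_bipartite_def
proof (intro allI impI)
  fix F assume "F \<subseteq> edges" "bipartite V (edges - F)"
  then have "real h \<le> real (card F)"
    using bipartite_deletion_card_ge[OF assms] by simp
  then show "1 / real L * real (card edges) \<le> real (card F)"
    using L_ge by (simp add: card_edges)
qed

end

section \<open>Fourier analysis on subsets\<close>

definition sgn_at :: "'a \<Rightarrow> 'a set \<Rightarrow> real" where
  "sgn_at i X = (if i \<in> X then - 1 else 1)"

definition chi :: "'a set \<Rightarrow> 'a set \<Rightarrow> real" where
  "chi T X = (\<Prod>i\<in>T. sgn_at i X)"

definition fourier :: "'a set \<Rightarrow> ('a set \<Rightarrow> real) \<Rightarrow> 'a set \<Rightarrow> real" where
  "fourier I h T = (\<Sum>X\<in>Pow I. h X * chi T X)"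

lemma abs_sgn_at [simp]: "\<bar>sgn_at i X\<bar> = 1"
  by (simp add: sgn_at_def)

lemma sgn_at_mult_self [simp]: "sgn_at i X * sgn_at i X = 1"
  by (simp add: sgn_at_def)

lemma abs_chi [simp]: "\<bar>chi T X\<bar> = 1"
  by (simp add: chi_def abs_prod)

lemma chi_mult_self [simp]: "chi T X * chi T X = 1"
  by (simp add: chi_def flip: prod.distrib)

lemma chi_eq_power_card_Int:
  assumes "finite T"
  shows "chi T X = (- 1) ^ card (T \<inter> X)"
proof -
  have "chi T X = (\<Prod>i\<in>T \<inter> X. - 1)"
    unfolding chi_def sgn_at_def prod.inter_restrict[OF assms] ..
  then show ?thesis
    by simp
qed

lemma chi_complement_right:
  assumes "V \<subseteq> G"
  shows "chi V (G - W) = (- 1) ^ card V * chi V W"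
proof -
  have "chi V (G - W) = (\<Prod>i\<in>V. (- 1) * sgn_at i W)"
    unfolding chi_def using assms by (intro prod.cong) (auto simp: sgn_at_def)
  then show ?thesis
    by (simp only: chi_def prod.distrib prod_constant)
qed

lemma chi_complement_left:
  assumes "finite I" "T \<subseteq> I"
  shows "chi (I - T) X = chi I X * chi T X"
proof -
  have "chi I X * chi T X = chi (I - T) X * (chi T X * chi T X)"
    unfolding chi_def prod.subset_diff[OF assms(2,1)] by (simp only: mult.assoc)
  then show ?thesis
    by simp
qed

lemma fourier_complement:
  assumes "finite I" "T \<subseteq> I"
  shows "fourier I h (I - T) = fourier I (\<lambda>X. h X * chi I X) T"
  by (simp add: fourier_def chi_complement_left[OF assms] mult.assoc)

lemma sum_chi_mult_chi:
  assumes "finite I" "X \<subseteq> I" "Y \<subseteq> I"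
  shows "(\<Sum>T\<in>Pow I. chi T X * chi T Y) = (if X = Y then 2 ^ card I else 0)"
proof -
  have "(\<Sum>T\<in>Pow I. chi T X * chi T Y) = (\<Sum>T\<in>Pow I. (\<Prod>i\<in>T. sgn_at i X * sgn_at i Y) * (\<Prod>i\<in>I - T. 1))"
    by (simp add: chi_def prod.distrib)
  also have "\<dots> = (\<Prod>i\<in>I. sgn_at i X * sgn_at i Y + 1)"
    using assms(1) by (rule prod_add[symmetric])
  also have "\<dots> = (if X = Y then 2 ^ card I else 0)"
  proof (cases "X = Y")
    case False
    then obtain i where "i \<in> I" "(i \<in> X) \<noteq> (i \<in> Y)"
      using assms by blast
    then have "sgn_at i X * sgn_at i Y + 1 = 0"
      by (auto simp: sgn_at_def)
    then show ?thesis
      using False \<open>i \<in> I\<close> assms(1) by (auto intro!: prod_zero)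
  qed simp
  finally show ?thesis .
qed

lemma parseval:
  assumes "finite I"
  shows "(\<Sum>T\<in>Pow I. (fourier I h T)\<^sup>2) = 2 ^ card I * (\<Sum>X\<in>Pow I. (h X)\<^sup>2)"
proof -
  have "(\<Sum>T\<in>Pow I. (fourier I h T)\<^sup>2) =
      (\<Sum>T\<in>Pow I. \<Sum>X\<in>Pow I. \<Sum>Y\<in>Pow I. (h X * h Y) * (chi T X * chi T Y))"
    by (simp add: fourier_def power2_eq_square sum_product mult_ac)
  also have "\<dots> = (\<Sum>X\<in>Pow I. \<Sum>Y\<in>Pow I. (h X * h Y) * (\<Sum>T\<in>Pow I. chi T X * chi T Y))"
    by (subst sum.swap, rule sum.cong, simp, subst sum.swap, simp add: sum_distrib_left)
  also have "\<dots> = (\<Sum>X\<in>Pow I. \<Sum>Y\<in>Pow I. (if X = Y then (h X)\<^sup>2 * 2 ^ card I else 0))"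
    by (intro sum.cong refl) (auto simp: sum_chi_mult_chi assms power2_eq_square)
  also have "\<dots> = 2 ^ card I * (\<Sum>X\<in>Pow I. (h X)\<^sup>2)"
    using assms by (simp add: sum_distrib_left mult_ac)
  finally show ?thesis .
qed

lemma sum_bounded_mult_sq_le_fourier:
  assumes G: "finite G" and B: "\<And>W. \<bar>B W\<bar> \<le> 1"
  shows "(\<Sum>W\<in>Pow G. B W * d W)\<^sup>2 \<le> (\<Sum>V\<in>Pow G. (fourier G d V)\<^sup>2)"
proof -
  have "(\<Sum>W\<in>Pow G. (B W)\<^sup>2) \<le> (\<Sum>W\<in>Pow G. 1)"
    using B by (intro sum_mono) (simp add: abs_square_le_1)
  then have B_sq: "(\<Sum>W\<in>Pow G. (B W)\<^sup>2) \<le> 2 ^ card G"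
    using G by (simp add: card_Pow)
  have "(\<Sum>W\<in>Pow G. B W * d W)\<^sup>2 \<le> (\<Sum>W\<in>Pow G. (B W)\<^sup>2) * (\<Sum>W\<in>Pow G. (d W)\<^sup>2)"
    by (rule Cauchy_Schwarz_ineq_sum)
  also have "\<dots> \<le> 2 ^ card G * (\<Sum>W\<in>Pow G. (d W)\<^sup>2)"
    using B_sq by (intro mult_right_mono sum_nonneg) auto
  finally show ?thesis
    by (simp only: parseval[OF G])
qed

section \<open>Khintchine's inequality\<close>

lemma cosh_le_exp_half_sq: "cosh x \<le> exp (x\<^sup>2 / 2)" for x :: real
proof -
  have cosh_abs: "cosh \<bar>x\<bar> = cosh x"
    by (simp add: abs_if)
  define y where "y = 2 * \<bar>x\<bar>"
  have pos: "1 + 1 / 2 * (exp y - 1) > 0"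
    using exp_gt_zero[of y] by (simp add: field_simps add_pos_pos)
  have "- y * (1 / 2) + ln (1 + 1 / 2 * (exp y - 1)) \<le> y\<^sup>2 / 8"
    by (rule Hoeffdings_lemma_aux) (simp_all add: y_def)
  then have "ln (1 + 1 / 2 * (exp y - 1)) \<le> x\<^sup>2 / 2 + \<bar>x\<bar>"
    by (simp add: y_def power_mult_distrib)
  then have "1 + 1 / 2 * (exp y - 1) \<le> exp (x\<^sup>2 / 2 + \<bar>x\<bar>)"
    using pos by (metis exp_le_cancel_iff exp_ln)
  then have "exp (- \<bar>x\<bar>) * (1 + 1 / 2 * (exp y - 1)) \<le> exp (- \<bar>x\<bar>) * exp (x\<^sup>2 / 2 + \<bar>x\<bar>)"
    by (intro mult_left_mono) auto
  then have "cosh \<bar>x\<bar> \<le> exp (x\<^sup>2 / 2)"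
    by (simp add: y_def cosh_field_def field_simps flip: exp_add)
  then show ?thesis
    unfolding cosh_abs .
qed

lemma sum_exp_signed:
  assumes "finite I"
  shows "(\<Sum>Y\<in>Pow I. exp (\<Sum>i\<in>I. a i * sgn_at i Y)) = (\<Prod>i\<in>I. 2 * cosh (a i))"
proof -
  have "exp (\<Sum>i\<in>I. a i * sgn_at i Y) = (\<Prod>i\<in>Y. exp (- a i)) * (\<Prod>i\<in>I - Y. exp (a i))"
    if "Y \<in> Pow I" for Y
  proof -
    have "exp (\<Sum>i\<in>I. a i * sgn_at i Y) =
        (\<Prod>i\<in>I - Y. exp (a i * sgn_at i Y)) * (\<Prod>i\<in>Y. exp (a i * sgn_at i Y))"
      using that assms by (simp add: exp_sum prod.subset_diff[of Y I])
    then show ?thesis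
      by (simp add: sgn_at_def mult.commute)
  qed
  then have "(\<Sum>Y\<in>Pow I. exp (\<Sum>i\<in>I. a i * sgn_at i Y)) = (\<Prod>i\<in>I. exp (- a i) + exp (a i))"
    by (simp add: prod_add[OF assms])
  also have "\<dots> = (\<Prod>i\<in>I. 2 * cosh (a i))"
    by (intro prod.cong refl) (simp add: cosh_field_def field_simps)
  finally show ?thesis .
qed

lemma sum_cosh_signed_le:
  assumes "finite I"
  shows "(\<Sum>Y\<in>Pow I. cosh (\<Sum>i\<in>I. a i * sgn_at i Y)) \<le> 2 ^ card I * exp ((\<Sum>i\<in>I. (a i)\<^sup>2) / 2)"
proof -
  let ?S = "\<lambda>a Y. \<Sum>i\<in>I. a i * sgn_at i Y"
  have "(\<Sum>Y\<in>Pow I. cosh (?S a Y)) = (\<Sum>Y\<in>Pow I. (exp (?S a Y) + exp (?S (\<lambda>i. - a i) Y)) / 2)"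
    by (intro sum.cong refl) (simp add: cosh_field_def sum_negf)
  also have "\<dots> = ((\<Sum>Y\<in>Pow I. exp (?S a Y)) + (\<Sum>Y\<in>Pow I. exp (?S (\<lambda>i. - a i) Y))) / 2"
    by (simp only: sum.distrib sum_divide_distrib[symmetric])
  also have "\<dots> = (\<Prod>i\<in>I. 2 * cosh (a i))"
    unfolding sum_exp_signed[OF assms] by simp
  also have "\<dots> \<le> (\<Prod>i\<in>I. 2 * exp ((a i)\<^sup>2 / 2))"
    by (intro prod_mono) (auto intro: cosh_le_exp_half_sq)
  also have "\<dots> = 2 ^ card I * exp (\<Sum>i\<in>I. (a i)\<^sup>2 / 2)"
    by (simp add: prod.distrib exp_sum[OF assms])
  finally show ?thesis
    by (simp add: sum_divide_distrib)
qed

lemma power_even_le_cosh: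
  fixes x :: real
  assumes "m > 0"
  shows "x ^ (2 * m) \<le> (2 * real m) ^ (2 * m) * exp (- real m) * cosh x"
proof -
  define n where "n = 2 * real m"
  have n: "n > 0"
    using assms by (simp add: n_def)
  have "\<bar>x\<bar> / n \<le> exp (\<bar>x\<bar> / n - 1)"
    using exp_ge_add_one_self[of "\<bar>x\<bar> / n - 1"] by simp
  then have "(\<bar>x\<bar> / n) ^ (2 * m) \<le> exp (\<bar>x\<bar> / n - 1) ^ (2 * m)"
    using n by (intro power_mono) auto
  also have "\<dots> = exp (\<bar>x\<bar> - n)"
    using n by (simp add: n_def right_diff_distrib flip: exp_of_nat_mult)
  finally have "x ^ (2 * m) \<le> n ^ (2 * m) * exp (\<bar>x\<bar> - n)"
    using n by (simp add: power_divide power_even_abs field_simps)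
  also have "exp (\<bar>x\<bar> - n) = exp (- real m) * (exp (- real m) * exp \<bar>x\<bar>)"
    by (simp add: n_def flip: exp_add)
  also have "\<dots> \<le> exp (- real m) * cosh x"
  proof (rule mult_left_mono)
    have "2 \<le> exp (real m)"
      using exp_ge_add_one_self[of "real m"] assms by linarith
    then have "exp (- real m) * exp \<bar>x\<bar> \<le> 1 / 2 * exp \<bar>x\<bar>"
      by (intro mult_right_mono) (auto simp: exp_minus field_simps)
    also have "\<dots> \<le> cosh x"
      by (simp add: cosh_field_def abs_if)
    finally show "exp (- real m) * exp \<bar>x\<bar> \<le> cosh x" .
  qed simp
  finally show ?thesis
    using n by (simp add: n_def mult.assoc mult_left_mono)
qed

lemma khintchine_normalized:
  assumes I: "finite I" and m: "m > 0" and a: "(\<Sum>i\<in>I. (a i)\<^sup>2) = 2 * real m"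
  shows "(\<Sum>Y\<in>Pow I. (\<Sum>i\<in>I. a i * sgn_at i Y) ^ (2 * m)) \<le> 2 ^ card I * (2 * real m) ^ (2 * m)"
proof -
  let ?S = "\<lambda>Y. \<Sum>i\<in>I. a i * sgn_at i Y"
  have "(\<Sum>Y\<in>Pow I. ?S Y ^ (2 * m)) \<le>
      (\<Sum>Y\<in>Pow I. (2 * real m) ^ (2 * m) * exp (- real m) * cosh (?S Y))"
    by (intro sum_mono power_even_le_cosh m)
  also have "\<dots> = (2 * real m) ^ (2 * m) * exp (- real m) * (\<Sum>Y\<in>Pow I. cosh (?S Y))"
    by (simp only: sum_distrib_left)
  also have "\<dots> \<le> (2 * real m) ^ (2 * m) * exp (- real m) * (2 ^ card I * exp ((\<Sum>i\<in>I. (a i)\<^sup>2) / 2))"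
    by (intro mult_left_mono sum_cosh_signed_le I) auto
  also have "\<dots> = 2 ^ card I * (2 * real m) ^ (2 * m)"
    by (simp add: a exp_minus)
  finally show ?thesis .
qed

text \<open>Scaling the sum of squares to \<open>2 * m\<close> is the optimal choice in Chernoff's method.\<close>

lemma khintchine:
  assumes I: "finite I" and m: "m > 0"
  shows "(\<Sum>Y\<in>Pow I. (\<Sum>i\<in>I. a i * sgn_at i Y) ^ (2 * m)) \<le>
    2 ^ card I * (2 * real m * (\<Sum>i\<in>I. (a i)\<^sup>2)) ^ m"
proof (cases "(\<Sum>i\<in>I. (a i)\<^sup>2) = 0")
  case True
  then have "\<forall>i\<in>I. a i = 0"
    using I by (simp add: sum_nonneg_eq_0_iff)
  then show ?thesis
    using m by (simp add: True power_0_left)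
next
  case False
  define A where "A = (\<Sum>i\<in>I. (a i)\<^sup>2)"
  define x where "x = sqrt (2 * real m / A)"
  have A: "A > 0"
    using False by (simp add: A_def less_le sum_nonneg)
  then have x: "x > 0" "x\<^sup>2 = 2 * real m / A"
    using m by (simp_all add: x_def)
  have "x ^ (2 * m) * (\<Sum>Y\<in>Pow I. (\<Sum>i\<in>I. a i * sgn_at i Y) ^ (2 * m)) =
      (\<Sum>Y\<in>Pow I. (\<Sum>i\<in>I. x * a i * sgn_at i Y) ^ (2 * m))"
    by (simp add: sum_distrib_left mult.assoc flip: power_mult_distrib)
  also have "\<dots> \<le> 2 ^ card I * (2 * real m) ^ (2 * m)"
  proof (rule khintchine_normalized[OF I m])
    have "(\<Sum>i\<in>I. (x * a i)\<^sup>2) = x\<^sup>2 * A"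
      by (simp add: A_def power_mult_distrib sum_distrib_left)
    then show "(\<Sum>i\<in>I. (x * a i)\<^sup>2) = 2 * real m"
      using A x(2) by simp
  qed
  also have "(2 * real m) ^ (2 * m) = (x\<^sup>2 * (2 * real m * A)) ^ m"
    unfolding x(2) power_mult using A by (simp add: power2_eq_square)
  also have "2 ^ card I * (x\<^sup>2 * (2 * real m * A)) ^ m =
      x ^ (2 * m) * (2 ^ card I * (2 * real m * A) ^ m)"
    by (simp add: power_mult power_mult_distrib)
  finally show ?thesis
    using x(1) by (simp add: A_def)
qed

section \<open>Averages over permutations\<close>

lemma permutes_inv_comp_agreeing:
  assumes q: "q permutes I" and p: "p permutes I" and agree: "\<And>x. x \<in> T \<Longrightarrow> p x = q x"
  shows "inv q \<circ> p permutes (I - T)"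
proof (rule permutes_superset)
  show "inv q \<circ> p permutes I"
    using p q by (intro permutes_compose permutes_inv)
  show "(inv q \<circ> p) x = x" if "x \<in> I - (I - T)" for x
    using that agree permutes_inverses[OF q] by simp
qed

lemma card_permutations_agreeing:
  assumes I: "finite I" and T: "T \<subseteq> I"
  shows "card {p. p permutes I \<and> restrict p T = f} \<le> fact (card I - card T)"
proof (cases "\<exists>q. q permutes I \<and> restrict q T = f")
  case True
  then obtain q where q: "q permutes I" "restrict q T = f"
    by blast
  have "card {p. p permutes I \<and> restrict p T = f} \<le> card {p. p permutes (I - T)}"
  proof (rule card_inj_on_le[where f = "\<lambda>p. inv q \<circ> p"])
    show "inj_on (\<lambda>p. inv q \<circ> p) {p. p permutes I \<and> restrict p T = f}"
    proof (rule inj_onI)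
      fix p p' assume "inv q \<circ> p = inv q \<circ> p'"
      then have "q \<circ> (inv q \<circ> p) = q \<circ> (inv q \<circ> p')"
        by simp
      then show "p = p'"
        using permutes_inv_o(1)[OF q(1)] by (simp flip: comp_assoc)
    qed
    have "p x = q x" if "restrict p T = f" "x \<in> T" for p x
      using fun_cong[OF trans[OF that(1) q(2)[symmetric]], of x] that(2) by simp
    then show "(\<lambda>p. inv q \<circ> p) ` {p. p permutes I \<and> restrict p T = f} \<subseteq> {p. p permutes (I - T)}"
      using permutes_inv_comp_agreeing[OF q(1)] by auto
    show "finite {p. p permutes (I - T)}"
      using I by (simp add: finite_permutations)
  qed
  also have "\<dots> = fact (card I - card T)"
    using I T by (intro card_permutations) (auto simp: card_Diff_subset finite_subset)
  finally show ?thesis .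
next
  case False
  then have "{p. p permutes I \<and> restrict p T = f} = {}"
    by blast
  then show ?thesis
    by (simp only: card.empty)
qed

lemma sum_permutations_le_sum_PiE:
  fixes G :: "('a \<Rightarrow> 'a) \<Rightarrow> real"
  assumes I: "finite I" and T: "T \<subseteq> I" and G: "\<And>f. G f \<ge> 0"
  shows "(\<Sum>p | p permutes I. G (restrict p T)) \<le> fact (card I - card T) * (\<Sum>f\<in>T \<rightarrow>\<^sub>E I. G f)"
proof -
  have fin: "finite (T \<rightarrow>\<^sub>E I)" "finite {p. p permutes I}"
    using I finite_subset[OF T I] by (simp_all add: finite_PiE finite_permutations)
  have restrict_mem: "(\<lambda>p. restrict p T) ` {p. p permutes I} \<subseteq> T \<rightarrow>\<^sub>E I"
    using T by (auto simp: restrict_PiE_iff permutes_in_image)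
  have card_le: "real (card {p. p permutes I \<and> restrict p T = f}) \<le> fact (card I - card T)" for f
    using of_nat_mono[OF card_permutations_agreeing[OF I T], where ?'a = real] by simp
  have "(\<Sum>p | p permutes I. G (restrict p T)) =
        (\<Sum>f\<in>T \<rightarrow>\<^sub>E I. \<Sum>p\<in>{p \<in> {p. p permutes I}. restrict p T = f}. G (restrict p T))"
    by (rule sum.group[OF fin(2,1) restrict_mem, symmetric])
  also have "\<dots> = (\<Sum>f\<in>T \<rightarrow>\<^sub>E I. card {p. p permutes I \<and> restrict p T = f} * G f)"
    by simp
  also have "\<dots> \<le> (\<Sum>f\<in>T \<rightarrow>\<^sub>E I. fact (card I - card T) * G f)"
    by (intro sum_mono mult_right_mono card_le G)
  finally show ?thesis
    by (simp add: sum_distrib_left)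
qed

lemma ex_permutation_image_eq:
  assumes "finite I" "T \<subseteq> I" "T' \<subseteq> I" "card T = card T'"
  obtains q where "q permutes I" "q ` T = T'"
proof -
  have fin: "finite T" "finite T'"
    using assms finite_subset by auto
  obtain a where a: "bij_betw a T T'"
    using fin assms(4) by (metis finite_same_card_bij)
  have "card (I - T) = card (I - T')"
    using assms fin by (simp add: card_Diff_subset)
  then obtain b where b: "bij_betw b (I - T) (I - T')"
    using assms(1) by (metis finite_Diff finite_same_card_bij)
  define q where "q x = (if x \<in> T then a x else if x \<in> I then b x else x)" for x
  have q_T: "bij_betw q T T'"
    using a by (subst bij_betw_cong[of _ _ a]) (auto simp: q_def)
  have "bij_betw q (I - T) (I - T')"
    using b by (subst bij_betw_cong[of _ _ b]) (auto simp: q_def)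
  then have "bij_betw q (T \<union> (I - T)) (T' \<union> (I - T'))"
    by (intro bij_betw_combine q_T) auto
  moreover have "T \<union> (I - T) = I" "T' \<union> (I - T') = I"
    using assms by auto
  ultimately have "q permutes I"
    using assms by (intro bij_imp_permutes) (auto simp: q_def)
  then show ?thesis
    using that q_T by (auto simp: bij_betw_def)
qed

lemma bij_betw_image_card_subsets:
  assumes "p permutes I"
  shows "bij_betw ((`) p) {S. S \<subseteq> I \<and> card S = n} {S. S \<subseteq> I \<and> card S = n}"
proof (rule bij_betwI[where g = "(`) (inv p)"])
  have image_mem: "q ` S \<subseteq> I \<and> card (q ` S) = n" if "q permutes I" "S \<subseteq> I" "card S = n" for q S
    using that by (metis card_image image_mono permutes_image permutes_inj_on)
  show "(`) p \<in> {S. S \<subseteq> I \<and> card S = n} \<rightarrow> {S. S \<subseteq> I \<and> card S = n}"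
    using image_mem[OF assms] by auto
  show "(`) (inv p) \<in> {S. S \<subseteq> I \<and> card S = n} \<rightarrow> {S. S \<subseteq> I \<and> card S = n}"
    using image_mem[OF permutes_inv[OF assms]] by auto
qed (auto simp: image_comp permutes_inv_o[OF assms])

lemma sum_permutations_image:
  fixes H :: "'a set \<Rightarrow> real"
  assumes I: "finite I" and T: "T \<subseteq> I"
  shows "real (card I choose card T) * (\<Sum>p | p permutes I. H (p ` T)) =
    fact (card I) * (\<Sum>S | S \<subseteq> I \<and> card S = card T. H S)"
proof -
  let ?C = "{S. S \<subseteq> I \<and> card S = card T}"
  have "(\<Sum>p | p permutes I. H (p ` S)) = (\<Sum>p | p permutes I. H (p ` T))" if "S \<in> ?C" for S
  proof -
    obtain q where q: "q permutes I" "q ` T = S"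
      using ex_permutation_image_eq[OF I T, of S] \<open>S \<in> ?C\<close>
      by (metis (mono_tags, lifting) mem_Collect_eq)
    show ?thesis
      using sum_permutations_compose_right[OF q(1), of "\<lambda>p. H (p ` T)"] q(2)
      by (simp only: image_comp[symmetric])
  qed
  then have "real (card ?C) * (\<Sum>p | p permutes I. H (p ` T)) =
      (\<Sum>S\<in>?C. \<Sum>p | p permutes I. H (p ` S))"
    by simp
  also have "\<dots> = (\<Sum>p | p permutes I. \<Sum>S\<in>?C. H (p ` S))"
    by (rule sum.swap)
  also have "\<dots> = (\<Sum>p | p permutes I. \<Sum>S\<in>?C. H S)"
    by (intro sum.cong refl sum.reindex_bij_betw bij_betw_image_card_subsets) simp
  finally show ?thesis
    using I by (simp add: n_subsets card_permutations)
qed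

lemma power_mult_fact_diff_le:
  assumes "2 * l \<le> N"
  shows "real N ^ l * fact (N - l) \<le> 2 ^ l * fact N"
  using assms
proof (induction l)
  case (Suc l)
  have fact_eq: "fact (N - l) = real (N - l) * fact (N - Suc l)"
    using Suc.prems by (metis Suc_diff_Suc Suc_le_lessD fact_Suc le_add2 mult_2 order_trans)
  have "real N ^ Suc l * fact (N - Suc l) \<le> real N ^ l * (2 * real (N - l)) * fact (N - Suc l)"
    using Suc.prems by (auto intro!: mult_right_mono mult_left_mono simp: of_nat_diff)
  also have "\<dots> = 2 * (real N ^ l * fact (N - l))"
    by (simp add: fact_eq)
  also have "\<dots> \<le> 2 * (2 ^ l * fact N)"
    using Suc by simp
  finally show ?case
    by simp
qed simp

section \<open>Symmetrised Fourier weights\<close>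

definition mass :: "'a set \<Rightarrow> ('a set \<Rightarrow> real) \<Rightarrow> real" where
  "mass I h = (\<Sum>X\<in>Pow I. \<bar>h X\<bar>)"

definition heavy :: "nat \<Rightarrow> 'a set \<Rightarrow> ('a set \<Rightarrow> real) \<Rightarrow> bool" where
  "heavy s I h \<longleftrightarrow> (\<forall>X. \<bar>h X\<bar> \<le> 1) \<and> 2 ^ card I \<le> 2 ^ s * mass I h"

definition correlation :: "'a set \<Rightarrow> 'a set \<Rightarrow> 'a set \<Rightarrow> real" where
  "correlation I X Y = (\<Sum>i\<in>I. sgn_at i X * sgn_at i Y)"

definition correlation_sum :: "'a set \<Rightarrow> ('a set \<Rightarrow> real) \<Rightarrow> (real \<Rightarrow> real) \<Rightarrow> real" where
  "correlation_sum I h u = (\<Sum>X\<in>Pow I. \<Sum>Y\<in>Pow I. \<bar>h X\<bar> * \<bar>h Y\<bar> * u (correlation I X Y))"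

definition orbit_weight :: "'a set \<Rightarrow> ('a set \<Rightarrow> real) \<Rightarrow> 'a set \<Rightarrow> real" where
  "orbit_weight I h T = (\<Sum>p | p permutes I. (fourier I h (p ` T))\<^sup>2)"

definition level_weight :: "'a set \<Rightarrow> ('a set \<Rightarrow> real) \<Rightarrow> nat \<Rightarrow> real" where
  "level_weight I h l = (\<Sum>T | T \<subseteq> I \<and> card T = l. (fourier I h T)\<^sup>2)"

lemma mass_nonneg [simp]: "mass I h \<ge> 0"
  by (simp add: mass_def sum_nonneg)

lemma mass_mult_chi [simp]: "mass I (\<lambda>X. h X * chi T X) = mass I h"
  by (simp add: mass_def abs_mult)

lemma heavy_mult_chi [simp]: "heavy s I (\<lambda>X. h X * chi T X) \<longleftrightarrow> heavy s I h"
  by (simp add: heavy_def abs_mult)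

lemma heavy_sum_sq_le:
  assumes "heavy s I h"
  shows "2 ^ card I * (\<Sum>X\<in>Pow I. (h X)\<^sup>2) \<le> 2 ^ s * (mass I h)\<^sup>2"
proof -
  have bounded: "\<bar>h X\<bar> \<le> 1" and mass_ge: "2 ^ card I \<le> 2 ^ s * mass I h" for X
    using assms by (simp_all add: heavy_def)
  have "(h X)\<^sup>2 \<le> \<bar>h X\<bar>" for X
    using mult_left_le[OF bounded[of X], of "\<bar>h X\<bar>"] by (simp add: power2_eq_square)
  then have "(\<Sum>X\<in>Pow I. (h X)\<^sup>2) \<le> mass I h"
    unfolding mass_def by (intro sum_mono)
  then have "2 ^ card I * (\<Sum>X\<in>Pow I. (h X)\<^sup>2) \<le> (2 ^ s * mass I h) * mass I h"
    using mass_ge by (intro mult_mono sum_nonneg) auto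
  then show ?thesis
    by (simp add: power2_eq_square mult.assoc)
qed

lemma correlation_sum_mono:
  assumes "\<And>x. u x \<le> v x"
  shows "correlation_sum I h u \<le> correlation_sum I h v"
  unfolding correlation_sum_def using assms by (intro sum_mono mult_left_mono) auto

lemma correlation_sum_nonneg: "(\<And>x. u x \<ge> 0) \<Longrightarrow> correlation_sum I h u \<ge> 0"
  by (simp add: correlation_sum_def sum_nonneg)

lemma correlation_sum_cmult: "correlation_sum I h (\<lambda>x. c * u x) = c * correlation_sum I h u"
  by (simp add: correlation_sum_def sum_distrib_left mult_ac)

lemma correlation_sum_one_add:
  "correlation_sum I h (\<lambda>x. 1 + u x) = (mass I h)\<^sup>2 + correlation_sum I h u"
  by (simp add: correlation_sum_def mass_def power2_eq_square sum_product distrib_left sum.distrib)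

lemma correlation_sum_even_power_le:
  assumes I: "finite I" and h: "\<And>X. \<bar>h X\<bar> \<le> 1" and m: "m > 0"
  shows "correlation_sum I h (\<lambda>x. x ^ (2 * m)) \<le>
      mass I h * (2 ^ card I * (2 * real m * real (card I)) ^ m)"
proof -
  have "(\<Sum>Y\<in>Pow I. \<bar>h X\<bar> * \<bar>h Y\<bar> * correlation I X Y ^ (2 * m)) \<le>
      \<bar>h X\<bar> * (2 ^ card I * (2 * real m * real (card I)) ^ m)" for X
  proof -
    have "(\<Sum>Y\<in>Pow I. \<bar>h X\<bar> * \<bar>h Y\<bar> * correlation I X Y ^ (2 * m)) \<le>
        (\<Sum>Y\<in>Pow I. \<bar>h X\<bar> * 1 * correlation I X Y ^ (2 * m))"
      using h by (intro sum_mono mult_right_mono mult_left_mono) (auto simp: zero_le_even_power)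
    also have "\<dots> = \<bar>h X\<bar> * (\<Sum>Y\<in>Pow I. (\<Sum>i\<in>I. sgn_at i X * sgn_at i Y) ^ (2 * m))"
      by (simp add: correlation_def sum_distrib_left)
    also have "\<dots> \<le> \<bar>h X\<bar> * (2 ^ card I * (2 * real m * (\<Sum>i\<in>I. (sgn_at i X)\<^sup>2)) ^ m)"
      by (intro mult_left_mono khintchine I m) simp
    finally show ?thesis
      by (simp add: power2_eq_square)
  qed
  then show ?thesis
    unfolding correlation_sum_def mass_def sum_distrib_right by (intro sum_mono)
qed

lemma sum_PiE_prod_sgn_at_sq:
  assumes "finite T" "finite I"
  shows "(\<Sum>f\<in>T \<rightarrow>\<^sub>E I. (\<Sum>X\<in>Pow I. h X * (\<Prod>i\<in>T. sgn_at (f i) X))\<^sup>2) =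
    (\<Sum>X\<in>Pow I. \<Sum>Y\<in>Pow I. h X * h Y * correlation I X Y ^ card T)"
proof -
  have "(\<Sum>f\<in>T \<rightarrow>\<^sub>E I. (\<Sum>X\<in>Pow I. h X * (\<Prod>i\<in>T. sgn_at (f i) X))\<^sup>2) =
      (\<Sum>f\<in>T \<rightarrow>\<^sub>E I. \<Sum>X\<in>Pow I. \<Sum>Y\<in>Pow I. h X * h Y * (\<Prod>i\<in>T. sgn_at (f i) X * sgn_at (f i) Y))"
    by (simp add: power2_eq_square sum_product prod.distrib mult_ac)
  also have "\<dots> = (\<Sum>X\<in>Pow I. \<Sum>Y\<in>Pow I. h X * h Y *
      (\<Sum>f\<in>T \<rightarrow>\<^sub>E I. \<Prod>i\<in>T. sgn_at (f i) X * sgn_at (f i) Y))"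
    by (subst sum.swap, rule sum.cong, simp, subst sum.swap, simp add: sum_distrib_left)
  finally show ?thesis
    using prod_sum_PiE[of T "\<lambda>_. I" "\<lambda>_ j. sgn_at j X * sgn_at j Y" for X Y] assms
    by (simp add: correlation_def)
qed

lemma orbit_weight_le_correlation_sum:
  assumes I: "finite I" and T: "T \<subseteq> I" and "even (card T)"
  shows "orbit_weight I h T \<le> fact (card I - card T) * correlation_sum I h (\<lambda>x. x ^ card T)"
proof -
  define G where "G f = (\<Sum>X\<in>Pow I. h X * (\<Prod>i\<in>T. sgn_at (f i) X))\<^sup>2" for f
  have "(fourier I h (p ` T))\<^sup>2 = G (restrict p T)" if "p permutes I" for p
  proof -
    have "inj_on p T"
      using that by (rule permutes_inj_on)
    then show ?thesis
      by (simp add: G_def fourier_def chi_def prod.reindex)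
  qed
  then have "orbit_weight I h T = (\<Sum>p | p permutes I. G (restrict p T))"
    by (simp add: orbit_weight_def)
  also have "\<dots> \<le> fact (card I - card T) * (\<Sum>f\<in>T \<rightarrow>\<^sub>E I. G f)"
    by (rule sum_permutations_le_sum_PiE[OF I T]) (simp add: G_def)
  also have "(\<Sum>f\<in>T \<rightarrow>\<^sub>E I. G f) = (\<Sum>X\<in>Pow I. \<Sum>Y\<in>Pow I. h X * h Y * correlation I X Y ^ card T)"
    unfolding G_def by (intro sum_PiE_prod_sgn_at_sq I finite_subset[OF T I])
  also have "\<dots> \<le> correlation_sum I h (\<lambda>x. x ^ card T)"
    unfolding correlation_sum_def using assms(3)
    by (intro sum_mono mult_right_mono) (auto simp: zero_le_even_power abs_mult[symmetric])
  finally show ?thesis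
    by simp
qed

lemma orbit_weight_le_normalized_correlation_sum:
  assumes I: "finite I" and T: "T \<subseteq> I" and even: "even (card T)" and "2 * card T \<le> card I"
  shows "orbit_weight I h T \<le>
    fact (card I) * correlation_sum I h (\<lambda>x. (2 / real (card I) * x) ^ card T)"
proof -
  define n l where "n = card I" and "l = card T"
  have "real n ^ l > 0"
    using assms(4) by (cases "n = 0") (auto simp: n_def l_def)
  then have "fact (n - l) \<le> fact n * (2 / real n) ^ l"
    using power_mult_fact_diff_le[of l n] assms(4)
    by (simp add: n_def l_def power_divide pos_le_divide_eq mult_ac)
  moreover have "correlation_sum I h (\<lambda>x. x ^ l) \<ge> 0"
    using even by (intro correlation_sum_nonneg) (simp add: l_def zero_le_even_power)
  ultimately have "fact (n - l) * correlation_sum I h (\<lambda>x. x ^ l) \<le>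
      fact n * (2 / real n) ^ l * correlation_sum I h (\<lambda>x. x ^ l)"
    by (rule mult_right_mono)
  then show ?thesis
    using orbit_weight_le_correlation_sum[OF I T even, of h]
    by (simp only: n_def l_def power_mult_distrib correlation_sum_cmult mult.assoc)
qed

lemma orbit_weight_eq_level_weight:
  assumes "finite I" "T \<subseteq> I"
  shows "real (card I choose card T) * orbit_weight I h T =
      fact (card I) * level_weight I h (card T)"
  unfolding orbit_weight_def level_weight_def using assms by (rule sum_permutations_image)

lemma orbit_weight_complement:
  assumes I: "finite I" and T: "T \<subseteq> I"
  shows "orbit_weight I h (I - T) = orbit_weight I (\<lambda>X. h X * chi I X) T"
  unfolding orbit_weight_def
proof (rule sum.cong)
  fix p assume "p \<in> {p. p permutes I}"
  then have p: "p permutes I"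
    by simp
  have "p ` (I - T) = I - p ` T"
    using p by (metis image_set_diff permutes_image permutes_inj)
  moreover have "p ` T \<subseteq> I"
    using p T by (metis image_mono permutes_image)
  ultimately show "(fourier I h (p ` (I - T)))\<^sup>2 = (fourier I (\<lambda>X. h X * chi I X) (p ` T))\<^sup>2"
    by (simp add: fourier_complement[OF I])
qed simp

lemma orbit_weight_nonneg: "orbit_weight I h T \<ge> 0"
  by (simp add: orbit_weight_def sum_nonneg)

lemma level_weight_nonneg: "level_weight I h l \<ge> 0"
  by (simp add: level_weight_def sum_nonneg)

lemma sum_level_weight:
  assumes "finite I"
  shows "(\<Sum>l\<le>card I. level_weight I h l) = 2 ^ card I * (\<Sum>X\<in>Pow I. (h X)\<^sup>2)"
proof -
  have "(\<Sum>l\<le>card I. level_weight I h l) =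
      (\<Sum>l\<in>{..card I}. \<Sum>T\<in>{T \<in> Pow I. card T = l}. (fourier I h T)\<^sup>2)"
    by (simp add: level_weight_def)
  also have "\<dots> = (\<Sum>T\<in>Pow I. (fourier I h T)\<^sup>2)"
    using assms card_mono by (intro sum.group) fastforce+
  finally show ?thesis
    by (simp only: parseval[OF assms])
qed

section \<open>Random unions of blocks\<close>

definition blocks :: "nat \<Rightarrow> nat set \<Rightarrow> nat set" where
  "blocks k V = {i. i div k \<in> V}"

lemma blocks_singleton: "k > 0 \<Longrightarrow> blocks k {j} = {j * k..<Suc j * k}"
  by (auto simp: blocks_def div_nat_eqI mult.commute dividend_less_times_div)

lemma blocks_eq_UN: "blocks k V = (\<Union>j\<in>V. blocks k {j})"
  by (auto simp: blocks_def)

lemma blocks_disjoint: "j \<noteq> j' \<Longrightarrow> blocks k {j} \<inter> blocks k {j'} = {}"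
  by (auto simp: blocks_def)

lemma card_blocks:
  assumes "k > 0" "finite V"
  shows "card (blocks k V) = k * card V"
proof -
  have "card (blocks k V) = card (\<Union>j\<in>V. blocks k {j})"
    by (subst blocks_eq_UN) (rule refl)
  also have "\<dots> = (\<Sum>j\<in>V. card (blocks k {j}))"
    using assms blocks_disjoint[of _ _ k]
    by (intro card_UN_disjoint ballI impI) (auto simp: blocks_singleton)
  also have "\<dots> = k * card V"
    using assms(1) by (simp add: blocks_singleton)
  finally show ?thesis .
qed

lemma blocks_subset: "V \<subseteq> {..<g} \<Longrightarrow> k > 0 \<Longrightarrow> blocks k V \<subseteq> {..<k * g}"
  by (auto simp: blocks_def div_less_iff_less_mult mult.commute dest!: subsetD)

lemma blocks_complement: "k > 0 \<Longrightarrow> blocks k ({..<g} - V) = {..<k * g} - blocks k V"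
  by (auto simp: blocks_def div_less_iff_less_mult mult.commute)

lemma binomial_mult_le: "(a choose b) * (c choose d) \<le> (a + c) choose (b + d)"
proof -
  have "(a choose b) * (c choose (b + d - b)) \<le> (\<Sum>k\<le>b + d. (a choose k) * (c choose (b + d - k)))"
    by (rule member_le_sum) auto
  then show ?thesis
    by (simp add: vandermonde)
qed

lemma binomial_power_le: "(g choose j) ^ k \<le> (k * g) choose (k * j)"
proof (induction k)
  case (Suc k)
  have "(g choose j) ^ Suc k \<le> (g choose j) * ((k * g) choose (k * j))"
    using Suc by simp
  also have "\<dots> \<le> (g + k * g) choose (j + k * j)"
    by (rule binomial_mult_le)
  finally show ?case
    by simp
qed simp

lemma two_power_le_binomial:
  assumes "J \<le> j" "J + j \<le> g"
  shows "2 ^ J \<le> g choose j"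
proof -
  have two_power_le: "2 ^ i \<le> g choose i" if "2 * i \<le> g" for i
  proof (cases "i = 0")
    case False
    then have "(2::real) ^ i \<le> (real g / real i) ^ i"
      using that by (intro power_mono) (auto simp: field_simps)
    also have "\<dots> \<le> real (g choose i)"
      using that by (intro binomial_ge_n_over_k_pow_k) simp
    finally show ?thesis
      by (metis of_nat_le_iff of_nat_numeral of_nat_power)
  qed simp
  show ?thesis
  proof (cases "2 * j \<le> g")
    case True
    then show ?thesis
      using two_power_le[of j] assms by (meson order_trans power_increasing one_le_numeral)
  next
    case False
    have "2 ^ J \<le> (2::nat) ^ (g - j)"
      using assms by (intro power_increasing) auto
    also have "\<dots> \<le> g choose (g - j)"
      using False by (intro two_power_le) simp
    finally show ?thesis
      using assms by (metis add_leD2 binomial_symmetric)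
  qed
qed

lemma orbit_weight_medium_blocks_le:
  assumes k: "k \<ge> 2" and V: "V \<subseteq> {..<g}" and J: "J \<le> card V" "J + card V \<le> g"
  shows "real (g choose card V) * orbit_weight {..<k * g} h (blocks k V) \<le>
    fact (k * g) / 2 ^ J * level_weight {..<k * g} h (k * card V)"
proof -
  define b where "b = real (g choose card V)"
  define w where "w = orbit_weight {..<k * g} h (blocks k V)"
  have card: "card (blocks k V) = k * card V"
    using k V by (intro card_blocks) (auto intro: finite_subset)
  have b_ge: "2 ^ J \<le> b"
    unfolding b_def by (metis two_power_le_binomial[OF J] of_nat_le_iff of_nat_numeral of_nat_power)
  then have "1 \<le> b"
    by (meson one_le_numeral one_le_power order_trans)
  have "2 ^ J * b \<le> b * b"
    using b_ge \<open>1 \<le> b\<close> by (intro mult_right_mono) auto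
  also have "\<dots> \<le> b ^ k"
    using \<open>1 \<le> b\<close> k power_increasing[of 2 k b] by (simp add: power2_eq_square)
  also have "\<dots> \<le> real ((k * g) choose (k * card V))"
    unfolding b_def by (metis binomial_power_le of_nat_le_iff of_nat_power)
  finally have "2 ^ J * b * w \<le> real ((k * g) choose (k * card V)) * w"
    unfolding w_def by (intro mult_right_mono orbit_weight_nonneg)
  also have "\<dots> = fact (k * g) * level_weight {..<k * g} h (k * card V)"
    using orbit_weight_eq_level_weight[of "{..<k * g}" "blocks k V" h] blocks_subset[OF V] k
    by (simp add: w_def card)
  finally show ?thesis
    by (simp add: b_def w_def field_simps)
qed

lemma sum_orbit_weight_medium_level_le:
  assumes k: "k \<ge> 2" and j: "J \<le> j" "J + j \<le> g"
  shows "(\<Sum>V | V \<subseteq> {..<g} \<and> card V = j. orbit_weight {..<k * g} h (blocks k V)) \<le>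
    fact (k * g) / 2 ^ J * level_weight {..<k * g} h (k * j)"
proof -
  define K where "K = fact (k * g) / 2 ^ J * level_weight {..<k * g} h (k * j)"
  have pos: "real (g choose j) > 0"
    using j(2) by simp
  have "orbit_weight {..<k * g} h (blocks k V) \<le> K / real (g choose j)"
    if "V \<in> {V. V \<subseteq> {..<g} \<and> card V = j}" for V
    using orbit_weight_medium_blocks_le[OF k, of V g J h] that j pos
    by (auto simp: K_def field_simps)
  then have "(\<Sum>V | V \<subseteq> {..<g} \<and> card V = j. orbit_weight {..<k * g} h (blocks k V)) \<le>
      real (card {V. V \<subseteq> {..<g} \<and> card V = j}) * (K / real (g choose j))"
    by (rule sum_bounded_above)
  then show ?thesis
    using pos by (simp add: n_subsets K_def)
qed

lemma sum_orbit_weight_medium_blocks_le: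
  assumes k: "k \<ge> 2" and h: "heavy s {..<k * g} h"
  shows "(\<Sum>V | V \<subseteq> {..<g} \<and> J \<le> card V \<and> J + card V \<le> g. orbit_weight {..<k * g} h (blocks k V)) \<le>
    2 ^ s / 2 ^ J * fact (k * g) * (mass {..<k * g} h)\<^sup>2"
proof -
  define N where "N = k * g"
  define w where "w V = orbit_weight {..<N} h (blocks k V)" for V
  define S where "S = {V. V \<subseteq> {..<g} \<and> J \<le> card V \<and> J + card V \<le> g}"
  define R where "R = {j. J \<le> j \<and> J + j \<le> g}"
  have "finite R"
    unfolding R_def by (rule finite_subset[of _ "{..g}"]) auto
  have level: "{V \<in> S. card V = j} = {V. V \<subseteq> {..<g} \<and> card V = j}" if "j \<in> R" for j
    using that by (auto simp: S_def R_def)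
  have "(\<Sum>V\<in>S. w V) = (\<Sum>j\<in>R. \<Sum>V\<in>{V \<in> S. card V = j}. w V)"
    using \<open>finite R\<close> by (intro sum.group[symmetric]) (auto simp: S_def R_def)
  also have "\<dots> \<le> (\<Sum>j\<in>R. fact N / 2 ^ J * level_weight {..<N} h (k * j))"
  proof (rule sum_mono)
    fix j assume "j \<in> R"
    then show "(\<Sum>V\<in>{V \<in> S. card V = j}. w V) \<le> fact N / 2 ^ J * level_weight {..<N} h (k * j)"
      unfolding level[OF \<open>j \<in> R\<close>] w_def N_def using k
      by (intro sum_orbit_weight_medium_level_le) (auto simp: R_def)
  qed
  also have "\<dots> = fact N / 2 ^ J * (\<Sum>l\<in>(\<lambda>j. k * j) ` R. level_weight {..<N} h l)"
    using k by (simp add: sum.reindex inj_on_def sum_distrib_left)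
  also have "\<dots> \<le> fact N / 2 ^ J * (\<Sum>l\<le>N. level_weight {..<N} h l)"
    by (intro mult_left_mono sum_mono2 level_weight_nonneg) (auto simp: R_def N_def)
  also have "\<dots> \<le> fact N / 2 ^ J * (2 ^ s * (mass {..<N} h)\<^sup>2)"
    using heavy_sum_sq_le[OF h] sum_level_weight[of "{..<N}" h]
    by (intro mult_left_mono) (simp_all add: N_def)
  finally show ?thesis
    by (simp add: S_def w_def N_def mult_ac)
qed

lemma power_le_one_add_power:
  fixes x :: real
  assumes "x \<ge> 0" "j \<le> J"
  shows "x ^ j \<le> 1 + x ^ J"
proof (cases "x \<le> 1")
  case True
  then show ?thesis
    using assms by (simp add: power_le_one add_increasing2)
next
  case False
  then show ?thesis
    using assms power_increasing[of j J x] by linarith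
qed

lemma sum_power_card_subsets:
  fixes x :: "'b :: comm_ring_1"
  assumes "finite A"
  shows "(\<Sum>V | V \<subseteq> A \<and> V \<noteq> {}. x ^ card V) = (1 + x) ^ card A - 1"
proof -
  have "(1 + x) ^ card A = (\<Prod>i\<in>A. x + 1)"
    by (simp add: add.commute)
  also have "\<dots> = (\<Sum>V\<in>Pow A. x ^ card V)"
    unfolding prod_add[OF assms] by simp
  also have "\<dots> = x ^ card ({} :: 'a set) + (\<Sum>V\<in>Pow A - {{}}. x ^ card V)"
    using assms by (intro sum.remove) auto
  also have "Pow A - {{}} = {V. V \<subseteq> A \<and> V \<noteq> {}}"
    by auto
  finally show ?thesis
    by simp
qed

lemma sum_power_card_subsets_le:
  fixes \<theta> :: real
  assumes "finite A" and \<theta>: "0 \<le> \<theta>" "\<theta> \<le> 1"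
  shows "(\<Sum>V | V \<subseteq> A \<and> V \<noteq> {}. (\<theta> / real (card A)) ^ card V) \<le> 2 * \<theta>"
proof -
  have "(1 + \<theta> / real (card A)) ^ card A \<le> exp (\<theta> / real (card A)) ^ card A"
    using \<theta>(1) by (intro power_mono exp_ge_add_one_self) simp
  also have "\<dots> \<le> exp \<theta>"
    using \<theta>(1) by (simp flip: exp_of_nat_mult)
  also have "\<dots> \<le> 1 + \<theta> + \<theta>\<^sup>2"
    using \<theta> by (rule exp_bound)
  also have "\<theta>\<^sup>2 \<le> \<theta>"
    using \<theta> by (simp add: power2_eq_square mult_left_le)
  finally show ?thesis
    by (simp add: sum_power_card_subsets[OF assms(1)])
qed

locale block_parameters =
  fixes t g J :: nat and \<theta> :: real
  assumes t_pos: "t > 0" and g_pos: "g > 0" and even_g: "even g" and J_pos: "J > 0"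
    and \<theta>_pos: "0 < \<theta>" and \<theta>_le_1: "\<theta> \<le> 1"
    and small_ratio: "real g / \<theta> * (4 * real J / real g) ^ t \<le> 1 / 2"
begin

abbreviation N :: nat where
  "N \<equiv> 2 * t * g"

abbreviation indices :: "nat set" where
  "indices \<equiv> {..<2 * t * g}"

lemma two_J_le_g: "2 * J \<le> g"
proof (rule ccontr)
  assume "\<not> 2 * J \<le> g"
  then have "1 \<le> (4 * real J / real g) ^ t"
    using g_pos by (intro one_le_power) (simp add: field_simps)
  moreover have "1 \<le> real g / \<theta>"
    using g_pos \<theta>_pos \<theta>_le_1 by (simp add: field_simps)
  ultimately have "1 * 1 \<le> real g / \<theta> * (4 * real J / real g) ^ t"
    by (intro mult_mono) auto
  then show False
    using small_ratio by linarith
qed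

definition interpolation_coeff :: real where
  "interpolation_coeff = (real g / \<theta>) ^ J * (2 / real N) ^ (2 * (t * J))"

text \<open>Interpolating between the powers \<open>0\<close> and \<open>J\<close> reduces all low levels to one moment.\<close>

lemma power_le_interpolation:
  assumes "j \<le> J"
  shows "(2 / real N * x) ^ (2 * t * j) \<le>
      (\<theta> / real g) ^ j * (1 + interpolation_coeff * x ^ (2 * (t * J)))"
proof -
  define u where "u = (2 / real N * x) ^ (2 * t)"
  have "u \<ge> 0"
    by (simp add: u_def zero_le_even_power)
  have "(2 / real N * x) ^ (2 * t * j) = u ^ j"
    by (simp only: u_def power_mult)
  also have "\<dots> = (\<theta> / real g) ^ j * (real g / \<theta> * u) ^ j"
    using g_pos \<theta>_pos by (simp flip: power_mult_distrib)
  also have "\<dots> \<le> (\<theta> / real g) ^ j * (1 + (real g / \<theta> * u) ^ J)"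
    using g_pos \<theta>_pos \<open>u \<ge> 0\<close> assms by (intro mult_left_mono power_le_one_add_power) auto
  also have "(real g / \<theta> * u) ^ J = interpolation_coeff * x ^ (2 * (t * J))"
    by (simp only: u_def interpolation_coeff_def power_mult_distrib power_mult mult.assoc)
  finally show ?thesis .
qed

lemma interpolation_coeff_moment_le:
  assumes h: "heavy s indices h" and "s \<le> J"
  shows "interpolation_coeff * correlation_sum indices h (\<lambda>x. x ^ (2 * (t * J))) \<le>
      (mass indices h)\<^sup>2"
proof -
  define M where "M = mass indices h"
  have bounded: "\<bar>h X\<bar> \<le> 1" and mass_ge: "2 ^ N \<le> 2 ^ s * M" for X
    using h by (simp_all add: heavy_def M_def)
  have "M \<ge> 0"
    by (simp add: M_def)
  have "interpolation_coeff \<ge> 0"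
    using g_pos \<theta>_pos by (simp add: interpolation_coeff_def)
  have "interpolation_coeff * (2 * real (t * J) * real N) ^ (t * J) =
      (real g / \<theta> * ((2 / real N)\<^sup>2 * (2 * real (t * J) * real N)) ^ t) ^ J"
    by (simp only: interpolation_coeff_def power_mult_distrib power_mult mult.assoc)
  also have "(2 / real N)\<^sup>2 * (2 * real (t * J) * real N) = 4 * real J / real g"
    using t_pos g_pos by (simp add: power2_eq_square field_simps)
  also have "(real g / \<theta> * (4 * real J / real g) ^ t) ^ J \<le> (1 / 2) ^ J"
    using small_ratio g_pos \<theta>_pos by (intro power_mono) auto
  finally have coeff_le: "interpolation_coeff * (2 * real (t * J) * real N) ^ (t * J) \<le>
      (1 / 2) ^ J" .
  have "interpolation_coeff * correlation_sum indices h (\<lambda>x. x ^ (2 * (t * J))) \<le>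
      interpolation_coeff * (M * (2 ^ N * (2 * real (t * J) * real N) ^ (t * J)))"
    using correlation_sum_even_power_le[of indices h "t * J"] bounded t_pos J_pos
      \<open>interpolation_coeff \<ge> 0\<close>
    by (intro mult_left_mono) (simp_all add: M_def)
  also have "\<dots> = M * (2 ^ N * (interpolation_coeff * (2 * real (t * J) * real N) ^ (t * J)))"
    by (simp only: mult_ac)
  also have "\<dots> \<le> M * ((2 ^ s * M) * (1 / 2) ^ J)"
    using mass_ge coeff_le \<open>M \<ge> 0\<close> \<open>interpolation_coeff \<ge> 0\<close>
    by (intro mult_left_mono mult_mono) auto
  also have "\<dots> = 2 ^ s / 2 ^ J * M\<^sup>2"
    by (simp add: power_one_over power2_eq_square)
  also have "\<dots> \<le> 1 * M\<^sup>2"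
    using \<open>s \<le> J\<close> by (intro mult_right_mono) (auto simp: divide_le_eq_1)
  finally show ?thesis
    by (simp add: M_def)
qed

lemma orbit_weight_small_blocks_le:
  assumes h: "heavy s indices h" "s \<le> J" and V: "V \<subseteq> {..<g}" "card V \<le> J"
  shows "orbit_weight indices h (blocks (2 * t) V) \<le>
    2 * fact N * (mass indices h)\<^sup>2 * (\<theta> / real g) ^ card V"
proof -
  let ?T = "blocks (2 * t) V"
  have T: "?T \<subseteq> indices"
    using V(1) t_pos by (intro blocks_subset) auto
  have card_T: "card ?T = 2 * t * card V"
    using V(1) t_pos by (intro card_blocks) (auto intro: finite_subset)
  have "2 * card V \<le> g"
    using V(2) two_J_le_g by linarith
  then have "2 * card ?T \<le> N"
    unfolding card_T by (metis mult.left_commute mult_le_mono2)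
  then have "orbit_weight indices h ?T \<le>
      fact N * correlation_sum indices h (\<lambda>x. (2 / real N * x) ^ (2 * t * card V))"
    using orbit_weight_le_normalized_correlation_sum[OF _ T, of h] by (simp add: card_T)
  also have "\<dots> \<le> fact N * correlation_sum indices h
      (\<lambda>x. (\<theta> / real g) ^ card V * (1 + interpolation_coeff * x ^ (2 * (t * J))))"
    using V(2) by (intro mult_left_mono correlation_sum_mono power_le_interpolation) auto
  also have "\<dots> = fact N * ((\<theta> / real g) ^ card V *
        ((mass indices h)\<^sup>2 +
          interpolation_coeff * correlation_sum indices h (\<lambda>x. x ^ (2 * (t * J)))))"
    by (simp only: correlation_sum_cmult correlation_sum_one_add)
  also have "\<dots> \<le> fact N * ((\<theta> / real g) ^ card V * ((mass indices h)\<^sup>2 + (mass indices h)\<^sup>2))"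
    using interpolation_coeff_moment_le[OF h] g_pos \<theta>_pos by (intro mult_left_mono) auto
  finally show ?thesis
    by (simp add: mult_ac)
qed

definition small_sets :: "nat set set" where
  "small_sets = {V. V \<subseteq> {..<g} \<and> 0 < card V \<and> card V \<le> J}"

definition medium_sets :: "nat set set" where
  "medium_sets = {V. V \<subseteq> {..<g} \<and> J \<le> card V \<and> J + card V \<le> g}"

lemma finite_small_sets: "finite small_sets" and finite_medium_sets: "finite medium_sets"
  by (simp_all add: small_sets_def medium_sets_def)

lemma sum_orbit_weight_small_blocks_le:
  assumes "heavy s indices h" "s \<le> J"
  shows "(\<Sum>V\<in>small_sets. orbit_weight indices h (blocks (2 * t) V)) \<le>
      4 * \<theta> * fact N * (mass indices h)\<^sup>2"
proof -
  have "(\<Sum>V\<in>small_sets. (\<theta> / real g) ^ card V) \<le> (\<Sum>V | V \<subseteq> {..<g} \<and> V \<noteq> {}. (\<theta> / real g) ^ card V)"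
    using \<theta>_pos by (intro sum_mono2) (auto simp: small_sets_def)
  also have "\<dots> \<le> 2 * \<theta>"
    using sum_power_card_subsets_le[of "{..<g}" \<theta>] \<theta>_pos \<theta>_le_1 by simp
  finally have power_sum_le: "(\<Sum>V\<in>small_sets. (\<theta> / real g) ^ card V) \<le> 2 * \<theta>" .
  have "(\<Sum>V\<in>small_sets. orbit_weight indices h (blocks (2 * t) V)) \<le>
      (\<Sum>V\<in>small_sets. 2 * fact N * (mass indices h)\<^sup>2 * (\<theta> / real g) ^ card V)"
    using assms by (intro sum_mono orbit_weight_small_blocks_le) (auto simp: small_sets_def)
  also have "\<dots> = 2 * fact N * (mass indices h)\<^sup>2 * (\<Sum>V\<in>small_sets. (\<theta> / real g) ^ card V)"
    by (simp add: sum_distrib_left)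
  also have "\<dots> \<le> 2 * fact N * (mass indices h)\<^sup>2 * (2 * \<theta>)"
    by (intro mult_left_mono power_sum_le) auto
  finally show ?thesis
    by (simp add: mult_ac)
qed

lemma odd_card_subset_cases:
  assumes V: "V \<subseteq> {..<g}" and odd: "odd (card V)"
  shows "V \<in> small_sets \<union> medium_sets \<union> (\<lambda>V. {..<g} - V) ` small_sets"
proof -
  have card_complement: "card ({..<g} - V) = g - card V"
    using V by (simp add: card_Diff_subset finite_subset)
  have "card V \<noteq> g" "card V \<noteq> 0"
    using odd even_g by (metis even_zero)+
  moreover have "card V \<le> g"
    using card_mono[of "{..<g}" V] V by simp
  ultimately consider (small) "0 < card V" "card V \<le> J"
    | (medium) "J \<le> card V" "J + card V \<le> g" | (large) "0 < g - card V" "g - card V \<le> J"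
    by linarith
  then show ?thesis
  proof cases
    case large
    then have "{..<g} - V \<in> small_sets"
      by (simp add: small_sets_def card_complement)
    moreover have "V = {..<g} - ({..<g} - V)"
      using V by auto
    ultimately show ?thesis
      by blast
  qed (use V in \<open>auto simp: small_sets_def medium_sets_def\<close>)
qed

lemma sum_orbit_weight_odd_blocks_le:
  assumes h: "heavy s indices h" and s: "s \<le> J"
  shows "(\<Sum>V | V \<subseteq> {..<g} \<and> odd (card V). orbit_weight indices h (blocks (2 * t) V)) \<le>
    (8 * \<theta> + 2 ^ s / 2 ^ J) * fact N * (mass indices h)\<^sup>2"
proof -
  define w where "w h V = orbit_weight indices h (blocks (2 * t) V)" for h V
  let ?large_sets = "(\<lambda>V. {..<g} - V) ` small_sets"
  have w_nonneg: "w h V \<ge> 0" for h V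
    by (simp add: w_def orbit_weight_nonneg)
  have sum_Un_le: "sum (w h) (\<A> \<union> \<B>) \<le> sum (w h) \<A> + sum (w h) \<B>" if "finite \<A>" "finite \<B>" for \<A> \<B>
    using that by (simp add: sum_Un w_nonneg sum_nonneg)
  have "w h ({..<g} - V) = w (\<lambda>X. h X * chi indices X) V" if "V \<in> small_sets" for V
    using that t_pos blocks_subset[of V g "2 * t"]
    by (simp add: w_def small_sets_def blocks_complement orbit_weight_complement)
  then have "sum (w h) ?large_sets = (\<Sum>V\<in>small_sets. w (\<lambda>X. h X * chi indices X) V)"
    by (subst sum.reindex) (auto simp: small_sets_def inj_on_def)
  then have large: "sum (w h) ?large_sets \<le> 4 * \<theta> * fact N * (mass indices h)\<^sup>2"
    using sum_orbit_weight_small_blocks_le[of s "\<lambda>X. h X * chi indices X"] h s by (simp add: w_def)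
  have small: "sum (w h) small_sets \<le> 4 * \<theta> * fact N * (mass indices h)\<^sup>2"
    unfolding w_def using h s by (rule sum_orbit_weight_small_blocks_le)
  have medium: "sum (w h) medium_sets \<le> 2 ^ s / 2 ^ J * fact N * (mass indices h)\<^sup>2"
    unfolding w_def medium_sets_def using t_pos h by (intro sum_orbit_weight_medium_blocks_le) auto
  have "(\<Sum>V | V \<subseteq> {..<g} \<and> odd (card V). w h V) \<le>
      sum (w h) (small_sets \<union> medium_sets \<union> ?large_sets)"
    using odd_card_subset_cases finite_small_sets finite_medium_sets w_nonneg
    by (intro sum_mono2) auto
  also have "\<dots> \<le> sum (w h) small_sets + sum (w h) medium_sets + sum (w h) ?large_sets"
    using sum_Un_le[of small_sets medium_sets] sum_Un_le[of "small_sets \<union> medium_sets" ?large_sets]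
      finite_small_sets finite_medium_sets by simp
  also have "\<dots> \<le> (8 * \<theta> + 2 ^ s / 2 ^ J) * fact N * (mass indices h)\<^sup>2"
    using small medium large by (simp add: algebra_simps)
  finally show ?thesis
    by (simp add: w_def)
qed

end

section \<open>Advantage of a one-way message\<close>

definition pushforward :: "'a set \<Rightarrow> ('a \<Rightarrow> 'b) \<Rightarrow> ('a \<Rightarrow> real) \<Rightarrow> 'b \<Rightarrow> real" where
  "pushforward A Q f y = (\<Sum>x | x \<in> A \<and> Q x = y. f x)"

lemma sum_mult_pushforward:
  assumes "finite A" "finite C" "Q ` A \<subseteq> C"
  shows "(\<Sum>y\<in>C. c y * pushforward A Q f y) = (\<Sum>x\<in>A. f x * c (Q x))"
proof -
  have "(\<Sum>y\<in>C. c y * pushforward A Q f y) = (\<Sum>y\<in>C. \<Sum>x | x \<in> A \<and> Q x = y. f x * c (Q x))"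
    unfolding pushforward_def sum_distrib_left by (intro sum.cong) auto
  also have "\<dots> = (\<Sum>x\<in>A. f x * c (Q x))"
    using assms by (rule sum.group)
  finally show ?thesis .
qed

definition odd_blocks :: "nat \<Rightarrow> nat \<Rightarrow> (nat \<Rightarrow> nat) \<Rightarrow> nat set \<Rightarrow> nat set" where
  "odd_blocks k g p X = {j. j < g \<and> odd (card (p ` blocks k {j} \<inter> X))}"

definition parity_gap :: "nat \<Rightarrow> nat \<Rightarrow> (nat \<Rightarrow> nat) \<Rightarrow> (nat set \<Rightarrow> real) \<Rightarrow> nat set \<Rightarrow> real" where
  "parity_gap k g p B X = B ({..<g} - odd_blocks k g p X) - B (odd_blocks k g p X)"

lemma odd_blocks_subset: "odd_blocks k g p X \<subseteq> {..<g}"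
  by (auto simp: odd_blocks_def)

lemma chi_odd_blocks:
  assumes k: "k > 0" and V: "V \<subseteq> {..<g}" and p: "inj p"
  shows "chi V (odd_blocks k g p X) = chi (p ` blocks k V) X"
proof -
  have fin: "finite (p ` blocks k {j})" for j
    using k by (simp add: blocks_singleton)
  have "finite V"
    using V by (rule finite_subset) simp
  have "chi V (odd_blocks k g p X) = (\<Prod>j\<in>V. chi (p ` blocks k {j}) X)"
    unfolding chi_def[of V]
  proof (rule prod.cong)
    fix j assume "j \<in> V"
    then show "sgn_at j (odd_blocks k g p X) = chi (p ` blocks k {j}) X"
      unfolding chi_eq_power_card_Int[OF fin] using V by (auto simp: sgn_at_def odd_blocks_def)
  qed simp
  also have "\<dots> = chi (\<Union>j\<in>V. p ` blocks k {j}) X"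
    unfolding chi_def using \<open>finite V\<close> fin p blocks_disjoint[of _ _ k]
    by (intro prod.UNION_disjoint[symmetric] ballI impI) (auto simp: image_Int[symmetric])
  also have "(\<Union>j\<in>V. p ` blocks k {j}) = p ` blocks k V"
    by (subst blocks_eq_UN) (simp only: image_UN)
  finally show ?thesis .
qed

definition parity_difference ::
    "'a set set \<Rightarrow> nat \<Rightarrow> ('a set \<Rightarrow> nat set) \<Rightarrow> ('a set \<Rightarrow> real) \<Rightarrow> nat set \<Rightarrow> real" where
  "parity_difference \<A> g P f W = pushforward \<A> (\<lambda>X. {..<g} - P X) f W - pushforward \<A> P f W"

lemma sum_mult_parity_difference:
  assumes "finite I"
  shows "(\<Sum>W\<in>Pow {..<g}. c W * parity_difference (Pow I) g (odd_blocks k g p) f W) =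
    (\<Sum>X\<in>Pow I. f X * parity_gap k g p c X)"
  using assms odd_blocks_subset
  by (simp add: parity_difference_def parity_gap_def right_diff_distrib sum_subtractf
      sum_mult_pushforward image_subset_iff)

lemma fourier_parity_difference:
  assumes I: "finite I" and k: "k > 0" and p: "inj p" and V: "V \<subseteq> {..<g}"
  shows "fourier {..<g} (parity_difference (Pow I) g (odd_blocks k g p) f) V =
    (if odd (card V) then - 2 * fourier I f (p ` blocks k V) else 0)"
proof -
  have gap_chi: "parity_gap k g p (chi V) X = ((- 1) ^ card V - 1) * chi (p ` blocks k V) X" for X
    by (simp add: parity_gap_def chi_complement_right[OF V] chi_odd_blocks[OF k V p]
        left_diff_distrib)
  have "fourier {..<g} (parity_difference (Pow I) g (odd_blocks k g p) f) V =
      (\<Sum>X\<in>Pow I. f X * parity_gap k g p (chi V) X)"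
    unfolding fourier_def sum_mult_parity_difference[OF I, symmetric] by (simp only: mult.commute)
  also have "\<dots> = ((- 1) ^ card V - 1) * fourier I f (p ` blocks k V)"
    by (simp add: gap_chi fourier_def sum_distrib_left mult_ac)
  finally show ?thesis
    by simp
qed

lemma sum_parity_gap_sq_le:
  assumes I: "finite I" and k: "k > 0" and p: "inj p" and B: "\<And>W. \<bar>B W\<bar> \<le> 1"
  shows "(\<Sum>X\<in>Pow I. f X * parity_gap k g p B X)\<^sup>2 \<le>
    4 * (\<Sum>V | V \<subseteq> {..<g} \<and> odd (card V). (fourier I f (p ` blocks k V))\<^sup>2)"
proof -
  let ?d = "parity_difference (Pow I) g (odd_blocks k g p) f"
  have "(\<Sum>X\<in>Pow I. f X * parity_gap k g p B X)\<^sup>2 \<le> (\<Sum>V\<in>Pow {..<g}. (fourier {..<g} ?d V)\<^sup>2)"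
    unfolding sum_mult_parity_difference[OF I, symmetric]
    by (intro sum_bounded_mult_sq_le_fourier B) simp
  also have "\<dots> = (\<Sum>V\<in>Pow {..<g}. if odd (card V) then 4 * (fourier I f (p ` blocks k V))\<^sup>2 else 0)"
    by (intro sum.cong refl) (simp add: fourier_parity_difference[OF I k p] power_mult_distrib)
  also have "\<dots> = (\<Sum>V\<in>{V \<in> Pow {..<g}. odd (card V)}. 4 * (fourier I f (p ` blocks k V))\<^sup>2)"
    by (rule sum.inter_filter[symmetric]) simp
  finally show ?thesis
    by (simp add: sum_distrib_left)
qed

context block_parameters
begin

definition total_gap :: "(nat set \<Rightarrow> real) \<Rightarrow> ((nat \<Rightarrow> nat) \<Rightarrow> nat set \<Rightarrow> real) \<Rightarrow> real" where
  "total_gap f B = (\<Sum>p | p permutes indices. \<Sum>X\<in>Pow indices. f X * parity_gap (2 * t) g p (B p) X)"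

lemma total_gap_le_mass:
  assumes B: "\<And>p W. 0 \<le> B p W" "\<And>p W. B p W \<le> 1"
  shows "total_gap f B \<le> fact N * mass indices f"
proof -
  have "\<bar>parity_gap (2 * t) g p (B p) X\<bar> \<le> 1" for p X
    unfolding parity_gap_def using B by (smt (verit))
  then have "f X * parity_gap (2 * t) g p (B p) X \<le> \<bar>f X\<bar>" for p X
    by (metis abs_ge_self abs_ge_zero abs_mult mult_left_le order_trans)
  then have "total_gap f B \<le> (\<Sum>p | p permutes indices. mass indices f)"
    unfolding total_gap_def mass_def by (intro sum_mono)
  then show ?thesis
    by (simp add: card_permutations)
qed

lemma total_gap_heavy_le:
  assumes f: "heavy s indices f" and s: "s \<le> J" and B: "\<And>p W. \<bar>B p W\<bar> \<le> 1"
  shows "total_gap f B \<le> 2 * sqrt (8 * \<theta> + 2 ^ s / 2 ^ J) * fact N * mass indices f"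
proof -
  define a where "a p = (\<Sum>X\<in>Pow indices. f X * parity_gap (2 * t) g p (B p) X)" for p
  define S where "S = {p. p permutes indices}"
  have card_S: "real (card S) = fact N"
    by (simp add: S_def card_permutations)
  have a_sq: "(a p)\<^sup>2 \<le>
      4 * (\<Sum>V | V \<subseteq> {..<g} \<and> odd (card V). (fourier indices f (p ` blocks (2 * t) V))\<^sup>2)"
    if "p \<in> S" for p
    unfolding a_def using that t_pos B
    by (intro sum_parity_gap_sq_le) (auto simp: S_def permutes_inj)
  have "(\<Sum>p\<in>S. a p)\<^sup>2 \<le> (\<Sum>p\<in>S. 1\<^sup>2) * (\<Sum>p\<in>S. (a p)\<^sup>2)"
    using Cauchy_Schwarz_ineq_sum[of "\<lambda>_. 1" a S] by simp
  also have "\<dots> = fact N * (\<Sum>p\<in>S. (a p)\<^sup>2)"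
    by (simp add: card_S)
  also have "\<dots> \<le> fact N *
      (\<Sum>p\<in>S. 4 * (\<Sum>V | V \<subseteq> {..<g} \<and> odd (card V). (fourier indices f (p ` blocks (2 * t) V))\<^sup>2))"
    by (intro mult_left_mono sum_mono a_sq) auto
  also have "\<dots> = 4 * fact N *
      (\<Sum>V | V \<subseteq> {..<g} \<and> odd (card V). orbit_weight indices f (blocks (2 * t) V))"
    unfolding orbit_weight_def S_def by (subst sum.swap) (simp add: sum_distrib_left mult_ac)
  also have "\<dots> \<le> 4 * fact N * ((8 * \<theta> + 2 ^ s / 2 ^ J) * fact N * (mass indices f)\<^sup>2)"
    using f s by (intro mult_left_mono sum_orbit_weight_odd_blocks_le) auto
  also have "\<dots> = (2 * sqrt (8 * \<theta> + 2 ^ s / 2 ^ J) * fact N * mass indices f)\<^sup>2"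
    using \<theta>_pos by (simp add: power_mult_distrib) (simp add: power2_eq_square)
  finally have "(\<Sum>p\<in>S. a p) \<le> 2 * sqrt (8 * \<theta> + 2 ^ s / 2 ^ J) * fact N * mass indices f"
    by (rule power2_le_imp_le) (use \<theta>_pos in simp)
  then show ?thesis
    by (simp add: a_def S_def total_gap_def)
qed

lemma total_gap_le:
  assumes f: "\<And>X. \<bar>f X\<bar> \<le> 1" and B: "\<And>p W. 0 \<le> B p W" "\<And>p W. B p W \<le> 1" and s: "s \<le> J"
  shows "total_gap f B \<le>
    fact N * 2 ^ N / 2 ^ s + 2 * sqrt (8 * \<theta> + 2 ^ s / 2 ^ J) * fact N * mass indices f"
proof (cases "heavy s indices f")
  case True
  have "total_gap f B \<le> 2 * sqrt (8 * \<theta> + 2 ^ s / 2 ^ J) * fact N * mass indices f"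
    using True s B by (intro total_gap_heavy_le) (auto simp: abs_le_iff add_increasing)
  then show ?thesis
    by (simp add: add_increasing)
next
  case False
  then have "mass indices f \<le> 2 ^ N / 2 ^ s"
    using f by (simp add: heavy_def field_simps)
  then have "fact N * mass indices f \<le> fact N * 2 ^ N / 2 ^ s"
    using mult_left_mono[of "mass indices f" "2 ^ N / 2 ^ s" "fact N"] by simp
  moreover have "total_gap f B \<le> fact N * mass indices f"
    using B by (rule total_gap_le_mass)
  moreover have "0 \<le> 2 * sqrt (8 * \<theta> + 2 ^ s / 2 ^ J) * fact N * mass indices f"
    using \<theta>_pos by simp
  ultimately show ?thesis
    by linarith
qed

lemma sum_total_gap_le:
  assumes M: "finite M" and f: "\<And>m X. 0 \<le> f m X" "\<And>m X. f m X \<le> 1"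
    and f_sum: "\<And>X. X \<subseteq> indices \<Longrightarrow> (\<Sum>m\<in>M. f m X) = 1"
    and B: "\<And>m p W. 0 \<le> B m p W" "\<And>m p W. B m p W \<le> 1" and s: "s \<le> J"
  shows "(\<Sum>m\<in>M. total_gap (f m) (B m)) \<le>
    (real (card M) / 2 ^ s + 2 * sqrt (8 * \<theta> + 2 ^ s / 2 ^ J)) * (fact N * 2 ^ N)"
proof -
  define \<epsilon> where "\<epsilon> = 2 * sqrt (8 * \<theta> + 2 ^ s / 2 ^ J)"
  have gap_le: "total_gap (f m) (B m) \<le>
      fact N * 2 ^ N / 2 ^ s + \<epsilon> * fact N * mass indices (f m)" for m
    unfolding \<epsilon>_def using f B s by (intro total_gap_le) simp_all
  have "(\<Sum>m\<in>M. mass indices (f m)) = (\<Sum>X\<in>Pow indices. \<Sum>m\<in>M. f m X)"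
    using f(1) by (simp add: mass_def sum.swap[of _ _ M])
  also have "\<dots> = 2 ^ N"
    using f_sum by (simp add: card_Pow)
  finally have mass_sum: "(\<Sum>m\<in>M. mass indices (f m)) = 2 ^ N" .
  have "(\<Sum>m\<in>M. total_gap (f m) (B m)) \<le>
      (\<Sum>m\<in>M. fact N * 2 ^ N / 2 ^ s + \<epsilon> * fact N * mass indices (f m))"
    by (intro sum_mono gap_le)
  also have "\<dots> = real (card M) * (fact N * 2 ^ N / 2 ^ s) + \<epsilon> * fact N * 2 ^ N"
    by (simp add: sum.distrib mass_sum flip: sum_distrib_left)
  finally show ?thesis
    by (simp add: \<epsilon>_def algebra_simps)
qed

end

section \<open>The streams\<close>

definition upper :: "nat \<Rightarrow> bool \<Rightarrow> nat" where
  "upper i a = 4 * i + of_bool a"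

definition lower :: "nat \<Rightarrow> bool \<Rightarrow> nat" where
  "lower i a = 4 * i + 2 + of_bool a"

definition extra :: "nat \<Rightarrow> nat \<Rightarrow> bool \<Rightarrow> nat" where
  "extra N j a = 4 * N + 2 * j + of_bool a"

definition gadgets :: "nat \<Rightarrow> nat set \<Rightarrow> nat set list" where
  "gadgets N X =
     map (\<lambda>(i, a). {upper i a, lower i (a \<noteq> (i \<in> X))}) (List.product [0..<N] [False, True])"

definition threads :: "nat \<Rightarrow> nat \<Rightarrow> (nat \<Rightarrow> nat) \<Rightarrow> nat set \<Rightarrow> nat set list" where
  "threads k g p W =
     map (\<lambda>(i, a). {lower (p i) a,
         if k dvd Suc i then extra (k * g) (i div k) a else upper (p (Suc i)) a})
       (List.product [0..<k * g] [False, True]) @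
     map (\<lambda>(j, a). {extra (k * g) j a, upper (p (j * k)) (a \<noteq> (j \<in> W))})
       (List.product [0..<g] [False, True])"

lemma length_gadgets: "length (gadgets N X) = 2 * N"
  by (simp add: gadgets_def)

lemma length_threads: "length (threads k g p W) = 2 * (k * g) + 2 * g"
  by (simp add: threads_def)

lemma gadget_edge_mem: "i < N \<Longrightarrow> {upper i a, lower i (a \<noteq> (i \<in> X))} \<in> set (gadgets N X)"
  unfolding gadgets_def set_map by (rule image_eqI[where x = "(i, a)"]) auto

lemma thread_edge_mem:
  "i < k * g \<Longrightarrow>
     {lower (p i) a, if k dvd Suc i then extra (k * g) (i div k) a else upper (p (Suc i)) a}
     \<in> set (threads k g p W)"
  unfolding threads_def set_append set_map by (rule UnI1, rule image_eqI[where x = "(i, a)"]) auto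

lemma closing_edge_mem:
  "j < g \<Longrightarrow> {extra (k * g) j a, upper (p (j * k)) (a \<noteq> (j \<in> W))} \<in> set (threads k g p W)"
  unfolding threads_def set_append set_map by (rule UnI2, rule image_eqI[where x = "(j, a)"]) auto

lemma vertex_cases:
  assumes "v < 4 * N + 2 * g"
  obtains (upper) i a where "i < N" "v = upper i a"
  | (lower) i a where "i < N" "v = lower i a"
  | (extra) j a where "j < g" "v = extra N j a"
proof (cases "v < 4 * N")
  case True
  then have i: "v div 4 < N"
    by simp
  have "v = 4 * (v div 4) + v mod 4"
    by simp
  moreover have "v mod 4 = of_bool (odd v) \<or> v mod 4 = 2 + of_bool (odd v)"
    by (cases "odd v") (simp_all, presburger+)
  ultimately have "v = upper (v div 4) (odd v) \<or> v = lower (v div 4) (odd v)"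
    unfolding upper_def lower_def by presburger
  then show ?thesis
    using upper[OF i] lower[OF i] by blast
next
  case False
  define y where "y = v - 4 * N"
  have "y div 2 < g"
    using assms False by (simp add: y_def less_mult_imp_div_less)
  moreover have "y = 2 * (y div 2) + of_bool (odd y)"
    by simp
  then have "v = extra N (y div 2) (odd y)"
    using False unfolding extra_def y_def by linarith
  ultimately show ?thesis
    by (rule extra)
qed

locale strands =
  fixes k g :: nat and p :: "nat \<Rightarrow> nat" and X :: "nat set"
  assumes k_pos: "k > 0" and p_permutes: "p permutes {..<k * g}"
begin

definition parity :: "nat \<Rightarrow> nat \<Rightarrow> bool" where
  "parity j r \<longleftrightarrow> odd (card (p ` {j * k..<j * k + r} \<inter> X))"

text \<open>Block \<open>j\<close> carries two strands, indexed by \<open>b\<close>; \<open>strand j b r\<close> is the vertex at position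
  \<open>r \<le> 2 * k\<close> of the strand that starts at \<open>upper (p (j * k)) b\<close>.\<close>

definition strand :: "nat \<Rightarrow> bool \<Rightarrow> nat \<Rightarrow> nat" where
  "strand j b r =
     (if r = 2 * k then extra (k * g) j (b \<noteq> parity j k)
      else if even r then upper (p (j * k + r div 2)) (b \<noteq> parity j (r div 2))
      else lower (p (j * k + r div 2)) (b \<noteq> parity j (Suc (r div 2))))"

definition position :: "nat \<Rightarrow> bool \<Rightarrow> nat \<Rightarrow> nat" where
  "position j b r = (2 * k + 1) * (2 * j + of_bool b) + r"

definition layout :: "nat \<Rightarrow> nat" where
  "layout q = strand (q div (2 * k + 1) div 2) (odd (q div (2 * k + 1))) (q mod (2 * k + 1))"

lemma parity_0 [simp]: "\<not> parity j 0"
  by (simp add: parity_def)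

lemma parity_Suc: "parity j (Suc r) \<longleftrightarrow> (parity j r \<noteq> (p (j * k + r) \<in> X))"
proof -
  let ?A = "p ` {j * k..<j * k + r} \<inter> X"
  have "p ` {j * k..<j * k + Suc r} \<inter> X =
      (if p (j * k + r) \<in> X then insert (p (j * k + r)) ?A else ?A)"
    by (simp add: atLeastLessThanSuc)
  moreover have "p (j * k + r) \<notin> ?A"
    by (simp add: inj_image_mem_iff[OF permutes_inj[OF p_permutes]])
  ultimately show ?thesis
    unfolding parity_def
    by (simp only: card_insert_disjoint finite_Int finite_imageI finite_atLeastLessThan
        split: if_split) auto
qed

lemma mem_odd_blocks_iff: "j < g \<Longrightarrow> j \<in> odd_blocks k g p X \<longleftrightarrow> parity j k"
  using k_pos by (simp add: odd_blocks_def parity_def blocks_singleton add.commute)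

lemma strand_upper: "i < k \<Longrightarrow> strand j b (2 * i) = upper (p (j * k + i)) (b \<noteq> parity j i)"
  by (simp add: strand_def)

lemma strand_lower: "strand j b (Suc (2 * i)) = lower (p (j * k + i)) (b \<noteq> parity j (Suc i))"
proof -
  have "Suc (2 * i) \<noteq> 2 * k"
    by presburger
  then show ?thesis
    by (simp add: strand_def)
qed

lemma strand_extra: "strand j b (2 * k) = extra (k * g) j (b \<noteq> parity j k)"
  by (simp add: strand_def)

lemma layout_position:
  assumes "r < 2 * k + 1"
  shows "layout (position j b r) = strand j b r"
proof -
  have "(L * s + r) div L = s" "(L * s + r) mod L = r" if "r < L" for L s :: nat
    using that by simp_all
  then have "position j b r div (2 * k + 1) = 2 * j + of_bool b"
    "position j b r mod (2 * k + 1) = r"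
    unfolding position_def using assms by blast+
  then show ?thesis
    by (simp add: layout_def)
qed

lemma positionE:
  assumes "q < (4 * k + 2) * g"
  obtains j b r where "j < g" "r < 2 * k + 1" "q = position j b r"
proof
  let ?s = "q div (2 * k + 1)"
  have "q < (2 * g) * (2 * k + 1)"
    using assms by (simp add: algebra_simps)
  then have "?s < 2 * g"
    by (simp add: div_less_iff_less_mult)
  then show "?s div 2 < g"
    by simp
  show "q mod (2 * k + 1) < 2 * k + 1"
    by simp
  have strand_index: "2 * (?s div 2) + of_bool (odd ?s) = ?s"
    by simp
  show "q = position (?s div 2) (odd ?s) (q mod (2 * k + 1))"
    unfolding position_def strand_index by (rule mult_div_mod_eq[symmetric])
qed

lemma position_less:
  assumes "j < g" "r < 2 * k + 1"
  shows "position j b r < (4 * k + 2) * g"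
proof -
  have "position j b r < (2 * k + 1) * (2 * j + of_bool b + 1)"
    using assms(2) by (simp add: position_def)
  also have "\<dots> \<le> (2 * k + 1) * (2 * g)"
    using assms(1) by (intro mult_le_mono2) auto
  finally show ?thesis
    by (simp add: algebra_simps)
qed

lemma block_indexE:
  assumes "i < k * g"
  obtains j r where "j < g" "r < k" "i = p (j * k + r)"
proof -
  obtain i' where i': "i' < k * g" "i = p i'"
    using assms permutes_image[OF p_permutes] by (metis imageE lessThan_iff)
  show ?thesis
    using that[of "i' div k" "i' mod k"] i' k_pos by (simp add: div_less_iff_less_mult mult.commute)
qed

lemma strand_surj:
  assumes "v < 4 * (k * g) + 2 * g"
  obtains j b r where "j < g" "r < 2 * k + 1" "v = strand j b r"
  using assms
proof (cases rule: vertex_cases)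
  case (upper i a)
  obtain j r where jr: "j < g" "r < k" "i = p (j * k + r)"
    using block_indexE[OF upper(1)] .
  then have "v = strand j (a \<noteq> parity j r) (2 * r)"
    unfolding strand_upper[OF jr(2)] upper(2) by (cases "parity j r") simp_all
  with jr show ?thesis
    by (intro that[of j "2 * r"]) auto
next
  case (lower i a)
  obtain j r where jr: "j < g" "r < k" "i = p (j * k + r)"
    using block_indexE[OF lower(1)] .
  then have "v = strand j (a \<noteq> parity j (Suc r)) (Suc (2 * r))"
    unfolding strand_lower lower(2) by (cases "parity j (Suc r)") simp_all
  with jr show ?thesis
    by (intro that[of j "Suc (2 * r)"]) auto
next
  case (extra j a)
  then have "v = strand j (a \<noteq> parity j k) (2 * k)"
    unfolding strand_extra by (cases "parity j k") simp_all
  with extra(1) show ?thesis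
    by (intro that[of j "2 * k" "a \<noteq> parity j k"]) auto
qed

lemma bij_betw_layout: "bij_betw layout {..<(4 * k + 2) * g} {..<(4 * k + 2) * g}"
proof -
  let ?A = "{..<(4 * k + 2) * g}"
  have "v \<in> layout ` ?A" if v: "v \<in> ?A" for v
  proof -
    have "v < 4 * (k * g) + 2 * g"
      using v by (simp add: algebra_simps)
    then obtain j b r where "j < g" "r < 2 * k + 1" "v = strand j b r"
      by (rule strand_surj)
    then show ?thesis
      using position_less[of j r b] layout_position[of r j b] by (metis image_eqI lessThan_iff)
  qed
  then have surj: "?A \<subseteq> layout ` ?A"
    by blast
  then have "inj_on layout ?A"
    by (intro finite_surj_inj) auto
  moreover have "?A = layout ` ?A"
    using surj by (intro card_seteq card_image_le) auto
  ultimately show ?thesis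
    by (simp add: bij_betw_def)
qed

lemma index_less:
  assumes "j < g" "i < k"
  shows "j * k + i < k * g"
proof -
  have "(j * k + i) div k = j"
    using assms(2) by simp
  then show ?thesis
    using assms(1) k_pos by (metis div_less_iff_less_mult mult.commute)
qed

lemma strand_gadget_edge_mem:
  assumes "j < g" "i < k"
  shows "{strand j b (2 * i), strand j b (Suc (2 * i))} \<in> set (gadgets (k * g) X)"
proof -
  have "p (j * k + i) < k * g"
    using permutes_in_image[OF p_permutes, of "j * k + i"] index_less[OF assms] by simp
  moreover have "strand j b (Suc (2 * i)) =
      lower (p (j * k + i)) ((b \<noteq> parity j i) \<noteq> (p (j * k + i) \<in> X))"
    unfolding strand_lower parity_Suc by (rule arg_cong[where f = "lower _"]) auto
  ultimately show ?thesis
    using gadget_edge_mem unfolding strand_upper[OF assms(2)] by simp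
qed

lemma strand_thread_edge_mem:
  assumes "j < g" "i < k"
  shows "{strand j b (Suc (2 * i)), strand j b (Suc (Suc (2 * i)))} \<in> set (threads k g p W)"
proof -
  define n where "n = j * k + i"
  let ?a = "b \<noteq> parity j (Suc i)"
  have n: "n div k = j" "k dvd Suc n \<longleftrightarrow> Suc i = k"
    using assms(2) by (auto simp: n_def mod_Suc dvd_eq_mod_eq_0)
  have "strand j b (Suc (Suc (2 * i))) =
      (if k dvd Suc n then extra (k * g) (n div k) ?a else upper (p (Suc n)) ?a)"
  proof (cases "Suc i = k")
    case True
    then have last: "Suc (Suc (2 * i)) = 2 * k"
      by simp
    show ?thesis
      unfolding last strand_extra using True n by simp
  next
    case False
    then have "Suc i < k"
      using assms(2) by simp
    moreover have "Suc (Suc (2 * i)) = 2 * Suc i"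
      by simp
    ultimately show ?thesis
      using False n strand_upper[of "Suc i" j b] by (simp add: n_def)
  qed
  moreover have "strand j b (Suc (2 * i)) = lower (p n) ?a"
    unfolding n_def by (rule strand_lower)
  moreover have "n < k * g"
    unfolding n_def using assms by (rule index_less)
  ultimately show ?thesis
    using thread_edge_mem[of n k g p ?a W] by simp
qed

lemma strand_edge_mem:
  assumes "j < g" "r < 2 * k"
  shows "{strand j b r, strand j b (Suc r)} \<in> set (gadgets (k * g) X @ threads k g p W)"
proof (cases "even r")
  case True
  then obtain i where "r = 2 * i"
    by (elim evenE)
  then show ?thesis
    using strand_gadget_edge_mem[OF assms(1), of i b] assms(2) by simp
next
  case False
  then obtain i where "r = Suc (2 * i)"
    by (auto elim: oddE)
  then show ?thesis
    using strand_thread_edge_mem[OF assms(1), of i b W] assms(2) by simp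
qed

lemma strand_closing_edge_mem:
  assumes "j < g" and "j \<in> W \<longleftrightarrow> parity j k \<noteq> twist"
  shows "{strand j b (2 * k), strand j (b \<noteq> twist) 0} \<in> set (gadgets (k * g) X @ threads k g p W)"
proof -
  let ?a = "b \<noteq> parity j k"
  have "(b \<noteq> twist) = (?a \<noteq> (j \<in> W))"
    using assms(2) by auto
  then have "strand j (b \<noteq> twist) 0 = upper (p (j * k)) (?a \<noteq> (j \<in> W))"
    using strand_upper[of 0 j "b \<noteq> twist"] k_pos by simp
  then show ?thesis
    using closing_edge_mem[OF assms(1), of k ?a p W] by (simp add: strand_extra)
qed

definition cycle_length :: "bool \<Rightarrow> nat" where
  "cycle_length twist = (if twist then 4 * k + 2 else 2 * k + 1)"

definition cycle_count :: "bool \<Rightarrow> nat" where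
  "cycle_count twist = (if twist then g else 2 * g)"

lemma cycle_length_mult_count: "cycle_length twist * cycle_count twist = (4 * k + 2) * g"
  by (simp add: cycle_length_def cycle_count_def)

lemma cyc_succ_position:
  assumes "r < 2 * k + 1"
  shows "cyc_succ (cycle_length twist) (position j b r) =
    (if r < 2 * k then position j b (Suc r) else position j (b \<noteq> twist) 0)"
proof (cases twist)
  case False
  then show ?thesis
    using assms cyc_succ_mult_add[OF assms, of "2 * j + of_bool b"]
    by (simp add: cycle_length_def position_def mod_Suc)
next
  case True
  let ?r = "(2 * k + 1) * of_bool b + r"
  have "position j b r = (4 * k + 2) * j + ?r" "?r < 4 * k + 2"
    using assms by (auto simp: position_def algebra_simps)
  then have "cyc_succ (4 * k + 2) (position j b r) = (4 * k + 2) * j + Suc ?r mod (4 * k + 2)"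
    using cyc_succ_mult_add by metis
  then show ?thesis
    using True assms by (cases b) (auto simp: cycle_length_def position_def mod_Suc algebra_simps)
qed

lemma layout_cycles_subset:
  assumes W: "\<forall>j<g. j \<in> W \<longleftrightarrow> parity j k \<noteq> twist"
  shows "(`) layout ` disjoint_cycles (cycle_length twist) (cycle_count twist) \<subseteq>
    set (gadgets (k * g) X @ threads k g p W)"
proof -
  have "layout ` {q, cyc_succ (cycle_length twist) q} \<in> set (gadgets (k * g) X @ threads k g p W)"
    if q_less: "q < (4 * k + 2) * g" for q
  proof -
    obtain j b r where jr: "j < g" "r < 2 * k + 1" and q: "q = position j b r"
      using positionE[OF q_less] .
    show ?thesis
    proof (cases "r < 2 * k")
      case True
      then show ?thesis
        using strand_edge_mem[OF jr(1) True, of b W]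
        by (simp add: q cyc_succ_position layout_position)
    next
      case False
      then have "r = 2 * k"
        using jr(2) by simp
      then show ?thesis
        using strand_closing_edge_mem[OF jr(1) W[rule_format, OF jr(1)], of b]
        by (simp add: q cyc_succ_position layout_position)
    qed
  qed
  then show ?thesis
    unfolding disjoint_cycles_def cycle_length_mult_count image_subset_iff by blast
qed

lemma cycle_embedding_layout:
  assumes "(4 * k + 2) * g \<le> M"
  shows "cycle_embedding (cycle_length twist) (cycle_count twist) layout {..<M}"
proof
  show "cycle_length twist \<ge> 3"
    using k_pos by (auto simp: cycle_length_def)
  show "inj_on layout {..<cycle_length twist * cycle_count twist}"
    "layout ` {..<cycle_length twist * cycle_count twist} \<subseteq> {..<M}"
    using bij_betw_layout assms unfolding cycle_length_mult_count bij_betw_def by auto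
qed simp

lemma
  assumes M: "(4 * k + 2) * g \<le> M" and W: "\<forall>j<g. j \<in> W \<longleftrightarrow> parity j k \<noteq> twist"
  shows set_stream: "set (gadgets (k * g) X @ threads k g p W) =
      (`) layout ` disjoint_cycles (cycle_length twist) (cycle_count twist)"
    and stream_mem_planar_streams: "gadgets (k * g) X @ threads k g p W \<in> planar_streams M"
proof -
  let ?stream = "gadgets (k * g) X @ threads k g p W"
  interpret cycle_embedding "cycle_length twist" "cycle_count twist" layout "{..<M}"
    by (rule cycle_embedding_layout[OF M])
  have subset: "edges \<subseteq> set ?stream"
    by (rule layout_cycles_subset[OF W])
  have "card edges = length ?stream"
    unfolding card_edges cycle_length_mult_count
    by (simp add: length_gadgets length_threads algebra_simps)
  moreover have "card edges \<le> card (set ?stream)"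
    using subset by (intro card_mono) auto
  moreover have "card (set ?stream) \<le> length ?stream"
    by (rule card_length)
  ultimately have card_eq: "card (set ?stream) = length ?stream" "card edges = card (set ?stream)"
    by linarith+
  show set_eq: "set ?stream = edges"
    using card_subset_eq[OF _ subset card_eq(2)] by simp
  show "?stream \<in> planar_streams M"
    unfolding planar_streams_def mem_Collect_eq set_eq
    using card_distinct[OF card_eq(1)] simple_graph planar by blast
qed

lemma yes_stream:
  assumes M: "(4 * k + 2) * g \<le> M"
  shows "gadgets (k * g) X @ threads k g p ({..<g} - odd_blocks k g p X) \<in> yes_streams M"
proof -
  interpret cycle_embedding "cycle_length True" "cycle_count True" layout "{..<M}"
    by (rule cycle_embedding_layout[OF M])
  have W: "\<forall>j<g. j \<in> {..<g} - odd_blocks k g p X \<longleftrightarrow> parity j k \<noteq> True"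
    using mem_odd_blocks_iff by simp
  have "bipartite {..<M} edges"
    by (rule bipartite_if_even) (simp add: cycle_length_def)
  then show ?thesis
    using stream_mem_planar_streams[OF M W]
    unfolding yes_streams_def mem_Collect_eq set_stream[OF M W]
    by blast
qed

lemma no_stream:
  assumes M: "(4 * k + 2) * g \<le> M" and g: "g > 0" and \<delta>: "\<delta> \<le> 1 / real (2 * k + 1)"
  shows "gadgets (k * g) X @ threads k g p (odd_blocks k g p X) \<in> no_streams \<delta> M"
proof -
  interpret cycle_embedding "cycle_length False" "cycle_count False" layout "{..<M}"
    by (rule cycle_embedding_layout[OF M])
  have W: "\<forall>j<g. j \<in> odd_blocks k g p X \<longleftrightarrow> parity j k \<noteq> False"
    using mem_odd_blocks_iff by simp
  have odd_length: "odd (cycle_length False)"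
    by (simp add: cycle_length_def)
  have "\<not> bipartite {..<M} edges"
    using g by (intro not_bipartite_if_odd[OF odd_length]) (simp add: cycle_count_def)
  moreover have "far_from_bipartite \<delta> {..<M} edges"
    using \<delta> by (intro far_from_bipartite_antimono[OF far_from_bipartite_if_odd[OF odd_length]])
      (simp add: cycle_length_def)
  ultimately show ?thesis
    using stream_mem_planar_streams[OF M W]
    unfolding no_streams_def mem_Collect_eq set_stream[OF M W]
    by blast
qed

end

lemma
  fixes t g M :: nat
  assumes "t > 0" "g > 0" and M: "(8 * t + 2) * g \<le> M" and p: "p permutes {..<2 * t * g}"
  shows even_block_yes_stream:
      "gadgets (2 * t * g) X @ threads (2 * t) g p ({..<g} - odd_blocks (2 * t) g p X)
        \<in> yes_streams M"
    and even_block_no_stream: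
      "gadgets (2 * t * g) X @ threads (2 * t) g p (odd_blocks (2 * t) g p X)
        \<in> no_streams (1 / (4 * real t + 2)) M"
proof -
  interpret strands "2 * t" g p X
    using assms(1) p by unfold_locales simp_all
  have M': "(4 * (2 * t) + 2) * g \<le> M"
    using M by simp
  then show "gadgets (2 * t * g) X @ threads (2 * t) g p ({..<g} - odd_blocks (2 * t) g p X)
      \<in> yes_streams M"
    by (rule yes_stream)
  show "gadgets (2 * t * g) X @ threads (2 * t) g p (odd_blocks (2 * t) g p X)
      \<in> no_streams (1 / (4 * real t + 2)) M"
    by (rule no_stream[OF M' assms(2)]) (simp add: field_simps)
qed

section \<open>Streaming algorithms as one-way protocols\<close>

definition resume :: "stream_alg \<Rightarrow> bool list \<Rightarrow> nat set list \<Rightarrow> bool pmf" where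
  "resume A m \<tau> =
     bind_pmf (foldl (\<lambda>D e. bind_pmf D (\<lambda>m. update A m e)) (return_pmf m) \<tau>) (answer A)"

lemma foldl_bind_pmf:
  "foldl (\<lambda>D e. bind_pmf D (\<lambda>m. u m e)) D \<tau> =
   bind_pmf D (\<lambda>m. foldl (\<lambda>D e. bind_pmf D (\<lambda>m. u m e)) (return_pmf m) \<tau>)"
proof (induction \<tau> arbitrary: D)
  case Nil
  then show ?case
    by (simp add: bind_return_pmf')
next
  case (Cons e \<tau>)
  let ?f = "foldl (\<lambda>D e. bind_pmf D (\<lambda>m. u m e))"
  have "?f D (e # \<tau>) = bind_pmf (bind_pmf D (\<lambda>m. u m e)) (\<lambda>m. ?f (return_pmf m) \<tau>)"
    by (simp only: foldl_Cons) (rule Cons.IH)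
  also have "\<dots> = bind_pmf D (\<lambda>m. bind_pmf (u m e) (\<lambda>m. ?f (return_pmf m) \<tau>))"
    by (rule bind_assoc_pmf)
  also have "\<dots> = bind_pmf D (\<lambda>m. ?f (u m e) \<tau>)"
    by (simp only: Cons.IH[symmetric])
  finally show ?case
    by (simp add: bind_return_pmf)
qed

lemma outcome_append: "outcome A (\<sigma> @ \<tau>) = bind_pmf (run A \<sigma>) (\<lambda>m. resume A m \<tau>)"
proof -
  have "run A (\<sigma> @ \<tau>) =
      bind_pmf (run A \<sigma>) (\<lambda>m. foldl (\<lambda>D e. bind_pmf D (\<lambda>m. update A m e)) (return_pmf m) \<tau>)"
    unfolding run_def foldl_append by (rule foldl_bind_pmf)
  then show ?thesis
    by (simp add: outcome_def resume_def bind_assoc_pmf)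
qed

lemma pmf_bind_finite:
  assumes "finite M" "set_pmf D \<subseteq> M"
  shows "pmf (bind_pmf D Q) x = (\<Sum>m\<in>M. pmf D m * pmf (Q m) x)"
  unfolding pmf_bind using assms by (subst integral_measure_pmf[of M]) (auto simp: set_pmf_iff)

lemma finite_short_bool_lists: "finite {m :: bool list. length m \<le> s}"
  using finite_lists_length_le[of "UNIV :: bool set" s] by simp

lemma card_short_bool_lists: "card {m :: bool list. length m \<le> s} \<le> 2 ^ (s + 1)"
proof -
  have "card {m :: bool list. length m \<le> s} = (\<Sum>i\<le>s. 2 ^ i)"
    using card_lists_length_le[of "UNIV :: bool set" s] by simp
  also have "\<dots> \<le> 2 ^ (s + 1)"
    by (induction s) auto
  finally show ?thesis .
qed

lemma set_pmf_run_subset: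
  assumes "uses_space A I s" "\<sigma> @ \<tau> \<in> I"
  shows "set_pmf (run A \<sigma>) \<subseteq> {m. length m \<le> s}"
proof -
  have "\<forall>i\<le>length (\<sigma> @ \<tau>). \<forall>m\<in>set_pmf (run A (take i (\<sigma> @ \<tau>))). length m \<le> s"
    using assms unfolding uses_space_def by blast
  from this[rule_format, of "length \<sigma>"] show ?thesis
    by auto
qed

lemma distinguishes_gap_ge:
  assumes "distinguishes P A \<delta> M" and space: "uses_space A (yes_streams M \<union> no_streams \<delta> M) s"
    and yes: "\<sigma> @ \<tau> \<in> yes_streams M" and no: "\<sigma> @ \<tau>' \<in> no_streams \<delta> M"
  shows "2 * P - 1 \<le> (\<Sum>m | length m \<le> s.
    pmf (run A \<sigma>) m * (pmf (resume A m \<tau>) True - pmf (resume A m \<tau>') True))"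
proof -
  have "set_pmf (run A \<sigma>) \<subseteq> {m. length m \<le> s}"
    using set_pmf_run_subset[OF space, of \<sigma> \<tau>] yes by simp
  then have outcome: "pmf (outcome A (\<sigma> @ \<rho>)) True =
      (\<Sum>m | length m \<le> s. pmf (run A \<sigma>) m * pmf (resume A m \<rho>) True)" for \<rho>
    unfolding outcome_append by (rule pmf_bind_finite[OF finite_short_bool_lists])
  have "P \<le> pmf (outcome A (\<sigma> @ \<tau>)) True" "P \<le> pmf (outcome A (\<sigma> @ \<tau>')) False"
    using assms(1) yes no unfolding distinguishes_def by blast+
  then have "2 * P - 1 \<le> pmf (outcome A (\<sigma> @ \<tau>)) True - pmf (outcome A (\<sigma> @ \<tau>')) True"
    by (simp add: pmf_False_conv_True)
  then show ?thesis
    by (simp add: outcome right_diff_distrib sum_subtractf)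
qed

lemma uses_space_0_indistinguishable:
  assumes "P > 1 / 2" "distinguishes P A \<delta> M" "uses_space A (yes_streams M \<union> no_streams \<delta> M) 0"
    and "\<sigma> \<in> yes_streams M" "\<tau> \<in> no_streams \<delta> M"
  shows False
proof -
  have "outcome A \<rho> = answer A []" if "\<rho> \<in> yes_streams M \<union> no_streams \<delta> M" for \<rho>
  proof -
    have "set_pmf (run A \<rho>) \<subseteq> {[]}"
      using set_pmf_run_subset[OF assms(3), of \<rho> "[]"] that by simp
    then show ?thesis
      by (simp add: set_pmf_subset_singleton outcome_def bind_return_pmf)
  qed
  then have "P \<le> pmf (answer A []) True" "P \<le> pmf (answer A []) False"
    using assms(2,4,5) unfolding distinguishes_def by force+
  then show False
    using assms(1) pmf_False_conv_True[of "answer A []"] by simp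
qed

context block_parameters
begin

lemma distinguishes_gap_sum_ge:
  assumes "distinguishes P A (1 / (4 * real t + 2)) M" and M: "(8 * t + 2) * g \<le> M"
    and "uses_space A (yes_streams M \<union> no_streams (1 / (4 * real t + 2)) M) s"
    and p: "p permutes indices"
  shows "2 * P - 1 \<le> (\<Sum>m | length m \<le> s. pmf (run A (gadgets N X)) m *
    parity_gap (2 * t) g p (\<lambda>W. pmf (resume A m (threads (2 * t) g p W)) True) X)"
  unfolding parity_gap_def
  by (rule distinguishes_gap_ge[OF assms(1,3) even_block_yes_stream[OF t_pos g_pos M p]
        even_block_no_stream[OF t_pos g_pos M p]])

lemma distinguishes_advantage_le:
  assumes dist: "distinguishes P A (1 / (4 * real t + 2)) M" and M: "(8 * t + 2) * g \<le> M"
    and space: "uses_space A (yes_streams M \<union> no_streams (1 / (4 * real t + 2)) M) s"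
    and s': "s' \<le> J"
  shows "2 * P - 1 \<le> 2 ^ (s + 1) / 2 ^ s' + 2 * sqrt (8 * \<theta> + 2 ^ s' / 2 ^ J)"
proof -
  define S where "S = {m :: bool list. length m \<le> s}"
  define f where "f m X = pmf (run A (gadgets N X)) m" for m X
  define B where "B m p = (\<lambda>W. pmf (resume A m (threads (2 * t) g p W)) True)" for m p
  have "finite S"
    unfolding S_def by (rule finite_short_bool_lists)
  have f_sum: "(\<Sum>m\<in>S. f m X) = 1" for X
  proof -
    have "gadgets N X @ threads (2 * t) g id ({..<g} - odd_blocks (2 * t) g id X) \<in> yes_streams M"
      using t_pos g_pos M by (intro even_block_yes_stream permutes_id)
    then have "set_pmf (run A (gadgets N X)) \<subseteq> S"
      unfolding S_def by (intro set_pmf_run_subset[OF space]) (rule UnI1)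
    then show ?thesis
      unfolding f_def using \<open>finite S\<close> by (intro sum_pmf_eq_1)
  qed
  have "(2 * P - 1) * (fact N * 2 ^ N) = (\<Sum>p | p permutes indices. \<Sum>X\<in>Pow indices. 2 * P - 1)"
    by (simp add: card_permutations card_Pow)
  also have "\<dots> \<le> (\<Sum>p | p permutes indices. \<Sum>X\<in>Pow indices.
      \<Sum>m\<in>S. f m X * parity_gap (2 * t) g p (B m p) X)"
    using distinguishes_gap_sum_ge[OF dist M space]
    by (intro sum_mono) (simp add: S_def f_def B_def)
  also have "\<dots> = (\<Sum>m\<in>S. total_gap (f m) (B m))"
    unfolding total_gap_def by (subst sum.swap[of _ S], subst sum.swap[of _ S], rule refl)
  also have "\<dots> \<le> (real (card S) / 2 ^ s' + 2 * sqrt (8 * \<theta> + 2 ^ s' / 2 ^ J)) * (fact N * 2 ^ N)"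
    using \<open>finite S\<close> f_sum s' by (intro sum_total_gap_le) (auto simp: f_def B_def pmf_le_1)
  finally have "2 * P - 1 \<le> real (card S) / 2 ^ s' + 2 * sqrt (8 * \<theta> + 2 ^ s' / 2 ^ J)"
    by (rule mult_right_le_imp_le) simp
  moreover have "real (card S) \<le> 2 ^ (s + 1)"
    unfolding S_def using card_short_bool_lists[of s]
    by (metis of_nat_le_iff of_nat_numeral of_nat_power)
  then have "real (card S) / 2 ^ s' \<le> 2 ^ (s + 1) / 2 ^ s'"
    by (rule divide_right_mono) simp
  ultimately show ?thesis
    by linarith
qed

end

section \<open>The space bound\<close>

lemma advantage_bound_less:
  fixes \<eta> :: real
  assumes \<eta>: "0 < \<eta>" "\<eta> \<le> 1" and K: "64 / \<eta>\<^sup>2 \<le> 2 ^ K"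
  shows "2 ^ (s + 1) / 2 ^ (s + K) + 2 * sqrt (8 * (\<eta>\<^sup>2 / 512) + 2 ^ (s + K) / 2 ^ (s + 2 * K)) < \<eta>"
proof -
  have K': "1 / 2 ^ K \<le> \<eta>\<^sup>2 / 64"
    using K \<eta> by (simp add: field_simps)
  have "2 ^ (s + 1) / 2 ^ (s + K) = 2 * (1 / 2 ^ K :: real)"
    by (simp add: power_add)
  also have "\<dots> \<le> \<eta>\<^sup>2 / 32"
    using K' by simp
  also have "\<dots> \<le> \<eta> / 32"
    using \<eta> by (simp add: power2_eq_square mult_left_le)
  finally have light: "2 ^ (s + 1) / 2 ^ (s + K) \<le> \<eta> / 32" .
  have "2 ^ (s + K) / 2 ^ (s + 2 * K) = (1 / 2 ^ K :: real)"
    by (simp add: power_add mult_2)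
  then have "8 * (\<eta>\<^sup>2 / 512) + 2 ^ (s + K) / 2 ^ (s + 2 * K) \<le> \<eta>\<^sup>2 / 64 + \<eta>\<^sup>2 / 64"
    using K' by simp
  also have "\<dots> \<le> (\<eta> / 5)\<^sup>2"
    by (simp add: power_divide)
  finally have "sqrt (8 * (\<eta>\<^sup>2 / 512) + 2 ^ (s + K) / 2 ^ (s + 2 * K)) \<le> \<eta> / 5"
    using \<eta> by (intro real_le_lsqrt) auto
  then show ?thesis
    using light \<eta> by linarith
qed

lemma powr_one_minus_inverse_power:
  assumes "n > 0" "t > 0"
  shows "(real n powr (1 - 1 / real t)) ^ t = real n ^ (t - 1)"
proof -
  have "(1 - 1 / real t) * real t = real (t - 1)"
    using assms(2) by (simp add: field_simps of_nat_diff)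
  then have "(real n powr (1 - 1 / real t)) ^ t = real n powr real (t - 1)"
    using assms by (simp add: powr_powr flip: powr_realpow)
  then show ?thesis
    using assms(1) by (simp add: powr_realpow)
qed

lemma small_ratio_if_le_powr:
  fixes d g \<theta> x :: real
  assumes "t > 0" "n > 0" "g > 0" and d: "d \<ge> 1" and n: "real n \<le> d * g" and \<theta>: "0 < \<theta>" "\<theta> \<le> 1"
    and x: "0 \<le> x" "4 * x \<le> \<theta> / (2 * d) * real n powr (1 - 1 / real t)"
  shows "g / \<theta> * (4 * x / g) ^ t \<le> 1 / 2"
proof -
  obtain u where t: "t = Suc u"
    using \<open>t > 0\<close> by (cases t) auto
  have powr_power: "(real n powr (1 - 1 / real t)) ^ t = real n ^ u"
    using powr_one_minus_inverse_power[OF \<open>n > 0\<close> \<open>t > 0\<close>] by (simp add: t)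
  have "(4 * x) ^ t \<le> (\<theta> / (2 * d) * real n powr (1 - 1 / real t)) ^ t"
    using x by (intro power_mono) auto
  also have "\<dots> = (\<theta> / (2 * d)) ^ t * real n ^ u"
    by (simp only: power_mult_distrib powr_power)
  also have "\<dots> = (\<theta> / 2) ^ t * (real n ^ u / d ^ t)"
    by (simp add: power_divide power_mult_distrib)
  also have "\<dots> \<le> \<theta> / 2 * ((d * g) ^ u / d ^ u)"
  proof (intro mult_mono frac_le power_mono n)
    show "(\<theta> / 2) ^ t \<le> \<theta> / 2"
      using \<theta> power_decreasing[of 1 t "\<theta> / 2"] \<open>t > 0\<close> by simp
    show "d ^ u \<le> d ^ t"
      using d by (simp add: t)
  qed (use \<theta> d \<open>g > 0\<close> in auto)
  also have "\<dots> = \<theta> / 2 * g ^ u"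
    using d by (simp add: power_mult_distrib)
  finally show ?thesis
    using \<theta> \<open>g > 0\<close> by (simp add: t power_divide field_simps)
qed

lemma ex_even_multiplier:
  fixes d n :: nat
  assumes "d > 0" "d \<le> n"
  obtains g where "even g" "g > 0" "d * g \<le> 2 * n" "n \<le> d * g"
proof
  let ?q = "n div d"
  have q: "?q \<ge> 1"
    using assms by (simp add: div_greater_zero_iff Suc_le_eq)
  then show "2 * ?q > 0" "even (2 * ?q)"
    by auto
  show "d * (2 * ?q) \<le> 2 * n"
    using times_div_less_eq_dividend[of d n] by simp
  have "n < d * (?q + 1)"
    using dividend_less_times_div[OF assms(1), of n] by simp
  also have "\<dots> \<le> d * (2 * ?q)"
    using q by (intro mult_le_mono2) simp
  finally show "n \<le> d * (2 * ?q)"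
    by simp
qed

lemma distinguishes_uses_space_pos:
  assumes "P > 1 / 2" "t > 0" "g > 0" "(8 * t + 2) * g \<le> M"
    and "distinguishes P A (1 / (4 * real t + 2)) M"
    and "uses_space A (yes_streams M \<union> no_streams (1 / (4 * real t + 2)) M) s"
  shows "s > 0"
proof (rule ccontr)
  assume "\<not> s > 0"
  then show False
    using uses_space_0_indistinguishable[OF assms(1,5) _
        even_block_yes_stream[OF assms(2-4) permutes_id]
        even_block_no_stream[OF assms(2-4) permutes_id]] assms(6) by simp
qed

lemma small_ratio_if_space_le:
  fixes t n s g K :: nat and \<theta> :: real
  assumes t: "t > 0" and n: "n > 0" "n \<le> (4 * t + 1) * g" and g: "g > 0" and \<theta>: "0 < \<theta>" "\<theta> \<le> 1"
    and s: "s > 0"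
      "real s \<le> \<theta> / (8 * (2 * real K + 1) * (4 * real t + 1)) * real n powr (1 - 1 / real t)"
  shows "real g / \<theta> * (4 * real (s + 2 * K) / real g) ^ t \<le> 1 / 2"
proof -
  define d r y where "d = 4 * real t + 1" and "r = 2 * real K + 1"
    and "y = real n powr (1 - 1 / real t)"
  have pos: "d \<ge> 1" "r > 0"
    by (simp_all add: d_def r_def)
  have "s + 2 * K \<le> (2 * K + 1) * s"
    using s(1) by (cases s) simp_all
  then have "real (s + 2 * K) \<le> real ((2 * K + 1) * s)"
    by (simp only: of_nat_le_iff)
  also have "\<dots> = r * real s"
    by (simp add: r_def algebra_simps)
  also have "\<dots> \<le> r * (\<theta> / (8 * r * d) * y)"
    using s(2) pos by (intro mult_left_mono) (simp_all add: d_def r_def y_def)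
  also have "\<dots> = \<theta> / (8 * d) * y"
    using pos by simp
  finally have "4 * real (s + 2 * K) \<le> \<theta> / (2 * d) * y"
    by (simp add: field_simps)
  moreover have "real n \<le> real ((4 * t + 1) * g)"
    using n(2) by (simp only: of_nat_le_iff)
  then have "real n \<le> d * real g"
    by (simp add: d_def algebra_simps)
  ultimately show ?thesis
    using t n(1) g pos \<theta> by (intro small_ratio_if_le_powr[where n = n and d = d]) (auto simp: y_def)
qed

lemma distinguishes_space_ge:
  fixes t n s K :: nat and \<eta> P :: real
  assumes t: "t > 0" and n: "4 * t + 1 \<le> n" and \<eta>: "0 < \<eta>" "\<eta> \<le> 1" "\<eta> \<le> 2 * P - 1"
    and K: "64 / \<eta>\<^sup>2 \<le> 2 ^ K"
    and dist: "distinguishes P A (1 / (4 * real t + 2)) (4 * n + 2)"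
    and space: "uses_space A
      (yes_streams (4 * n + 2) \<union> no_streams (1 / (4 * real t + 2)) (4 * n + 2)) s"
  shows "\<eta>\<^sup>2 / 512 / (8 * (2 * real K + 1) * (4 * real t + 1)) * real n powr (1 - 1 / real t)
    \<le> real s"
proof (rule ccontr)
  assume "\<not> ?thesis"
  then have s_le: "real s \<le>
      \<eta>\<^sup>2 / 512 / (8 * (2 * real K + 1) * (4 * real t + 1)) * real n powr (1 - 1 / real t)"
    by (simp only: not_le less_imp_le)
  have \<theta>: "0 < \<eta>\<^sup>2 / 512" "\<eta>\<^sup>2 / 512 \<le> 1"
    using \<eta> power_le_one[of \<eta> 2] by auto
  obtain g where g: "even g" "g > 0" "(4 * t + 1) * g \<le> 2 * n" "n \<le> (4 * t + 1) * g"
    using ex_even_multiplier[OF _ n] by auto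
  have M: "(8 * t + 2) * g \<le> 4 * n + 2"
    using g(3) by simp
  have "s > 0"
    using distinguishes_uses_space_pos[OF _ t g(2) M dist space] \<eta> by simp
  have "n > 0"
    using n by simp
  interpret block_parameters t g "s + 2 * K" "\<eta>\<^sup>2 / 512"
    using t g(1,2) \<theta> \<open>s > 0\<close> small_ratio_if_space_le[OF t \<open>n > 0\<close> g(4,2) \<theta> \<open>s > 0\<close> s_le]
    by unfold_locales auto
  have "2 * P - 1 \<le>
      2 ^ (s + 1) / 2 ^ (s + K) + 2 * sqrt (8 * (\<eta>\<^sup>2 / 512) + 2 ^ (s + K) / 2 ^ (s + 2 * K))"
    using dist M space by (rule distinguishes_advantage_le) simp
  also have "\<dots> < \<eta>"
    using \<eta>(1,2) K by (rule advantage_bound_less)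
  finally show False
    using \<eta>(3) by simp
qed

theorem theorem5p7:
  fixes t :: nat and p :: real
  assumes "t \<ge> 1" and "odd t" and "p > 1 / 2"
  shows "\<exists>c>0. \<forall>\<^sub>F n in sequentially. \<forall>(A :: stream_alg) (s :: nat).
           distinguishes p A (1 / (4 * real t + 2)) (4 * n + 2) \<and>
           uses_space A (yes_streams (4 * n + 2) \<union> no_streams (1 / (4 * real t + 2)) (4 * n + 2)) s
           \<longrightarrow> c * real n powr (1 - 1 / real t) \<le> real s"
proof -
  define \<eta> where "\<eta> = min 1 (2 * p - 1)"
  have \<eta>: "0 < \<eta>" "\<eta> \<le> 1" "\<eta> \<le> 2 * p - 1"
    using assms(3) by (auto simp: \<eta>_def)
  obtain K where K: "64 / \<eta>\<^sup>2 < 2 ^ K"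
    using real_arch_pow[of 2 "64 / \<eta>\<^sup>2"] by auto
  define c where "c = \<eta>\<^sup>2 / 512 / (8 * (2 * real K + 1) * (4 * real t + 1))"
  have "c > 0"
    using \<eta>(1) by (simp add: c_def)
  moreover have "c * real n powr (1 - 1 / real t) \<le> real s"
    if "n \<ge> 4 * t + 1" and "distinguishes p A (1 / (4 * real t + 2)) (4 * n + 2)"
      and "uses_space A
        (yes_streams (4 * n + 2) \<union> no_streams (1 / (4 * real t + 2)) (4 * n + 2)) s" for n A s
    unfolding c_def using assms(1) that \<eta> K
    by (intro distinguishes_space_ge[where P = p and A = A]) auto
  ultimately show ?thesis
    unfolding eventually_sequentially by blast
qed

end
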